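(* Let $(\Omega,d,\mu)$ be a metric measure space. Let $Q>0$, $0<\theta<1$, $0<p<\infty$, $0<q\le\infty$, and set $p_0:=\min\{1,p\}$. Let $X$ be an r.i. space on $\Omega$ such that $X^{(1/p)}$ is an r.i. space, and assume that $$D_{X,p}:=\sup_{s>0}\|A_s\|_{X^{(1/p)}\to X^{(1/p)}}<\infty .$$ Then the following assertions are equivalent. (i) There is a constant $C>0$ such that for every measurable function $f$ with $|f|^{p_0}\in L^1(\mu)+L^\infty(\mu)$, $$\left(\int_0^\infty\left[\varphi_X(t)\,t^{-\theta/Q}\,O(|f|^{p_0},t)^{1/p_0}\right]^q\frac{dt}t\right)^{1/q}\le C\,\|f\|_{\dot{\mathcal B}^{\theta,p}_{X,q}},$$ with the integral replaced by a supremum over $t>0$ when $q=\infty$. (ii) There is a constant $c>0$ such that $h_\mu(r):=\inf_{x\in\Omega}\mu(B(x,r))\ge c\,r^Q$ for all $r>0$.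
   Context: Metric measure space: $(\Omega,d)$ is a separable metric space, $\mu$ is a nonatomic Borel measure on $\Omega$ (in particular $\mu(\{x\})=0$ for all $x$) with $\mu(\Omega)=\infty$ and $0<\mu(B)<\infty$ for every open ball $B=B(x,r)=\{y:d(x,y)<r\}$. Rearrangements: for measurable $f$, $f^*(t)=\inf\{\lambda\ge0:\mu\{|f|>\lambda\}\le t\}$, $f^{**}(t)=\frac1t\int_0^tf^*(s)\,ds$, $O(f,t)=f^{**}(t)-f^*(t)$. R.i. space: a Banach space $X$ of ($\mu$-a.e. classes of) measurable functions with the lattice property ($|f|\le|g|$, $g\in X$ imply $f\in X$, $\|f\|_X\le\|g\|_X$), the Fatou property ($0\le f_n\uparrow f$ a.e. implies $\|f_n\|_X\uparrow\|f\|_X$), and rearrangement invariance ($f^*=g^*$, $f\in X$ imply $g\in X$, $\|g\|_X=\|f\|_X$); one has $L^1\cap L^\infty\subset X\subset L^1+L^\infty$ continuously. Fundamental function: $\varphi_X(t)=\|\chi_E\|_X$ for $\mu(E)=t$. Convexification: for $0<\kappa<\infty$, $X^{(\kappa)}=\{f:|f|^\kappa\in X\}$ with $\|f\|_{X^{(\kappa)}}=\||f|^\kappa\|_X^{1/\kappa}$. Averaging operators: $A_sh(x)=\frac1{\mu(B(x,s))}\int_{B(x,s)}h\,d\mu$. Averaged Besov seminorm: $\nabla_r^pf(x)=\Big(\frac1{\mu(B(x,r))}\int_{B(x,r)}|f(x)-f(y)|^p\,d\mu(y)\Big)^{1/p}$, $E_X^p(f,r)=\|\nabla_r^pf\|_X$,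 and, for $f\in L^p_{\mathrm{loc}}(\Omega)$, $\|f\|_{\dot{\mathcal B}^{\theta,p}_{X,q}}=\Big(\int_0^\infty\big(r^{-\theta}E_X^p(f,r)\big)^q\frac{dr}r\Big)^{1/q}$ (for $q=\infty$: $\sup_{r>0}r^{-\theta}E_X^p(f,r)$). The seminorm is $+\infty$ if $f\notin L^p_{\mathrm{loc}}(\Omega)$, and $\|\cdot\|_X=+\infty$ outside $X$. *)

theory Defs
  imports "HOL-Probability.Essential_Supremum"
begin

text \<open>Conventions. The underlying set is the whole type, functions are real-valued, and an extended
  norm or seminorm takes values in \<^typ>\<open>ennreal\<close>. Spaces of classes modulo null sets are represented
  by the set of all representatives.\<close>

locale metric_measure_space =
  fixes M :: "'a::metric_space measure"
  assumes separable: "separable_space (euclidean :: 'a topology)"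
    and borel_measure: "sets M = sets borel"
    and nonatomic: "\<And>A. A \<in> sets M \<Longrightarrow> 0 < emeasure M A \<Longrightarrow>
          \<exists>B\<in>sets M. B \<subseteq> A \<and> 0 < emeasure M B \<and> emeasure M B < emeasure M A"
    and infinite_total_measure: "emeasure M UNIV = \<infinity>"
    and ball_positive: "\<And>x r. 0 < r \<Longrightarrow> 0 < emeasure M (ball x r)"
    and ball_finite: "\<And>x r. 0 < r \<Longrightarrow> emeasure M (ball x r) < \<infinity>"

definition ball_growth :: "'a::metric_space measure \<Rightarrow> real \<Rightarrow> ennreal" where
  "ball_growth M r = (INF x. emeasure M (ball x r))"

text \<open>Positive real powers of extended nonnegative numbers; only used with \<open>s > 0\<close>.\<close>

definition epow :: "ennreal \<Rightarrow> real \<Rightarrow> ennreal" where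
  "epow a s = (if a = \<infinity> then \<infinity> else ennreal (enn2real a powr s))"

text \<open>The (quasi-)norm of \<open>L\<^sup>q((0,\<infinity>), dt/t)\<close>, \<open>0 < q \<le> \<infinity>\<close>, with the pointwise supremum for \<open>q = \<infinity>\<close>.\<close>

definition Lq_dt_over_t :: "ennreal \<Rightarrow> (real \<Rightarrow> ennreal) \<Rightarrow> ennreal" where
  "Lq_dt_over_t q F =
     (if q = \<infinity> then (SUP t\<in>{0<..}. F t)
      else epow (\<integral>\<^sup>+t\<in>{0<..}. epow (F t) (enn2real q) / ennreal t \<partial>lborel) (1 / enn2real q))"


definition rearr :: "'a measure \<Rightarrow> ('a \<Rightarrow> real) \<Rightarrow> real \<Rightarrow> ennreal" where
  "rearr M f t =
     Inf {ennreal l | l. 0 \<le> l \<and> emeasure M {x \<in> space M. l < \<bar>f x\<bar>} \<le> ennreal t}"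

definition rearr_avg :: "'a measure \<Rightarrow> ('a \<Rightarrow> real) \<Rightarrow> real \<Rightarrow> ennreal" where
  "rearr_avg M f t = (\<integral>\<^sup>+s\<in>{0<..<t}. rearr M f s \<partial>lborel) / ennreal t"

text \<open>The subtraction is not truncating: \<open>f\<^sup>*(t) \<le> f\<^sup>*\<^sup>*(t)\<close> because \<open>f\<^sup>*\<close> is nonincreasing.\<close>

definition osc :: "'a measure \<Rightarrow> ('a \<Rightarrow> real) \<Rightarrow> real \<Rightarrow> ennreal" where
  "osc M f t = rearr_avg M f t - rearr M f t"


definition L1_norm :: "'a measure \<Rightarrow> ('a \<Rightarrow> real) \<Rightarrow> ennreal" where
  "L1_norm M f = (\<integral>\<^sup>+x. ennreal \<bar>f x\<bar> \<partial>M)"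

definition Linf_norm :: "'a measure \<Rightarrow> ('a \<Rightarrow> real) \<Rightarrow> ennreal" where
  "Linf_norm M f = esssup M (\<lambda>x. ennreal \<bar>f x\<bar>)"

definition L1 :: "'a measure \<Rightarrow> ('a \<Rightarrow> real) set" where
  "L1 M = {f \<in> borel_measurable M. L1_norm M f < \<infinity>}"

definition Linf :: "'a measure \<Rightarrow> ('a \<Rightarrow> real) set" where
  "Linf M = {f \<in> borel_measurable M. Linf_norm M f < \<infinity>}"

definition L1_plus_Linf :: "'a measure \<Rightarrow> ('a \<Rightarrow> real) set" where
  "L1_plus_Linf M = {\<lambda>x. g x + h x | g h. g \<in> L1 M \<and> h \<in> Linf M}"

definition L1_plus_Linf_norm :: "'a measure \<Rightarrow> ('a \<Rightarrow> real) \<Rightarrow> ennreal" where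
  "L1_plus_Linf_norm M f =
     Inf {L1_norm M g + Linf_norm M h | g h. g \<in> L1 M \<and> h \<in> Linf M \<and> f = (\<lambda>x. g x + h x)}"


definition ext_norm :: "('a \<Rightarrow> real) set \<Rightarrow> (('a \<Rightarrow> real) \<Rightarrow> real) \<Rightarrow> ('a \<Rightarrow> real) \<Rightarrow> ennreal" where
  "ext_norm X N f = (if f \<in> X then ennreal (N f) else \<infinity>)"

text \<open>A rearrangement invariant Banach function space \<open>X\<close> with norm \<open>N\<close> (whose values outside \<open>X\<close> are
  irrelevant). The two continuous embeddings exclude the trivial space \<open>{0}\<close>.\<close>

locale ri_space =
  fixes M :: "'a measure" and X :: "('a \<Rightarrow> real) set" and N :: "('a \<Rightarrow> real) \<Rightarrow> real"
  assumes measurable: "X \<subseteq> borel_measurable M"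
    and ae_class: "\<And>f g. f \<in> X \<Longrightarrow> g \<in> borel_measurable M \<Longrightarrow> (AE x in M. f x = g x) \<Longrightarrow>
          g \<in> X \<and> N g = N f"
    and zero_mem: "(\<lambda>x. 0) \<in> X"
    and add_mem: "\<And>f g. f \<in> X \<Longrightarrow> g \<in> X \<Longrightarrow> (\<lambda>x. f x + g x) \<in> X"
    and scale_mem: "\<And>f c. f \<in> X \<Longrightarrow> (\<lambda>x. c * f x) \<in> X"
    and norm_nonneg: "\<And>f. f \<in> X \<Longrightarrow> 0 \<le> N f"
    and norm_eq_zero: "\<And>f. f \<in> X \<Longrightarrow> N f = 0 \<longleftrightarrow> (AE x in M. f x = 0)"
    and norm_scale: "\<And>f c. f \<in> X \<Longrightarrow> N (\<lambda>x. c * f x) = \<bar>c\<bar> * N f"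
    and norm_triangle: "\<And>f g. f \<in> X \<Longrightarrow> g \<in> X \<Longrightarrow> N (\<lambda>x. f x + g x) \<le> N f + N g"
    and complete: "\<And>u :: nat \<Rightarrow> 'a \<Rightarrow> real. (\<And>i. u i \<in> X) \<Longrightarrow>
          (\<forall>e>0. \<exists>K. \<forall>i\<ge>K. \<forall>j\<ge>K. N (\<lambda>x. u i x - u j x) < e) \<Longrightarrow>
          \<exists>f\<in>X. (\<lambda>i. N (\<lambda>x. u i x - f x)) \<longlonglongrightarrow> 0"
    and lattice: "\<And>f g. f \<in> borel_measurable M \<Longrightarrow> g \<in> X \<Longrightarrow> (AE x in M. \<bar>f x\<bar> \<le> \<bar>g x\<bar>) \<Longrightarrow>
          f \<in> X \<and> N f \<le> N g"
    and fatou: "\<And>(u :: nat \<Rightarrow> 'a \<Rightarrow> real) f.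
          (\<And>i. u i \<in> borel_measurable M) \<Longrightarrow> f \<in> borel_measurable M \<Longrightarrow>
          (AE x in M. \<forall>i. 0 \<le> u i x \<and> u i x \<le> u (Suc i) x) \<Longrightarrow>
          (AE x in M. (\<lambda>i. u i x) \<longlonglongrightarrow> f x) \<Longrightarrow>
          (\<lambda>i. ext_norm X N (u i)) \<longlonglongrightarrow> ext_norm X N f"
    and rearrangement_invariant: "\<And>f g. f \<in> X \<Longrightarrow> g \<in> borel_measurable M \<Longrightarrow>
          (\<forall>t>0. rearr M f t = rearr M g t) \<Longrightarrow> g \<in> X \<and> N g = N f"
    and intersection_embeds: "L1 M \<inter> Linf M \<subseteq> X"
    and intersection_embeds_continuous: "\<exists>K::real. \<forall>f \<in> L1 M \<inter> Linf M.
          ennreal (N f) \<le> ennreal K * max (L1_norm M f) (Linf_norm M f)"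
    and embeds_sum: "X \<subseteq> L1_plus_Linf M"
    and embeds_sum_continuous: "\<exists>K::real. \<forall>f \<in> X. L1_plus_Linf_norm M f \<le> ennreal (K * N f)"

text \<open>In an r.i. space the norm of an indicator depends only on the measure of the set
  (\<open>fundamental_eq\<close> below), and on a nonatomic space of infinite measure every \<open>t \<ge> 0\<close> is the measure
  of some set, so the choice is harmless.\<close>

definition fundamental :: "'a measure \<Rightarrow> (('a \<Rightarrow> real) \<Rightarrow> real) \<Rightarrow> real \<Rightarrow> real" where
  "fundamental M N t = N (indicator (SOME E. E \<in> sets M \<and> emeasure M E = ennreal t))"

lemma rearr_indicator_cong:
  assumes "E \<in> sets M" "F \<in> sets M" "emeasure M E = emeasure M F"
  shows "rearr M (indicator E) t = rearr M (indicator F) t"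
proof -
  have *: "emeasure M {x \<in> space M. l < \<bar>indicator A x :: real\<bar>} = (if l < 1 then emeasure M A else 0)"
    if "A \<in> sets M" "0 \<le> l" for A and l :: real
  proof -
    have "{x \<in> space M. l < \<bar>indicator A x :: real\<bar>} = (if l < 1 then A else {})"
      using that sets.sets_into_space[OF that(1)] by (auto simp: indicator_def)
    then show ?thesis by simp
  qed
  show ?thesis
    unfolding rearr_def using *[OF assms(1)] *[OF assms(2)] assms(3)
    by (intro arg_cong[where f = Inf]) (auto cong: conj_cong)
qed

lemma indicator_mem_L1_Linf:
  assumes "E \<in> sets M" "emeasure M E < \<infinity>"
  shows "(indicator E :: 'a \<Rightarrow> real) \<in> L1 M \<inter> Linf M"
proof -
  have 1: "L1_norm M (indicator E) = emeasure M E"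
  proof -
    have "(\<lambda>x. ennreal \<bar>indicator E x\<bar>) = indicator E"
      by (auto simp: indicator_def)
    then show ?thesis
      unfolding L1_norm_def using assms(1) by simp
  qed
  have "esssup M (\<lambda>x. ennreal \<bar>indicator E x\<bar>) \<le> 1"
    by (rule esssup_I) (use assms in \<open>auto simp: indicator_def\<close>)
  then have 2: "Linf_norm M (indicator E) < \<infinity>"
    unfolding Linf_norm_def by (rule le_less_trans) simp
  show ?thesis
    using 1 2 assms unfolding L1_def Linf_def by auto
qed

lemma (in ri_space) fundamental_eq:
  assumes "E \<in> sets M" "emeasure M E = ennreal t"
  shows "fundamental M N t = N (indicator E)"
proof -
  define F where "F = (SOME E. E \<in> sets M \<and> emeasure M E = ennreal t)"
  have F: "F \<in> sets M" "emeasure M F = ennreal t"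
    using someI[of "\<lambda>E. E \<in> sets M \<and> emeasure M E = ennreal t" E] assms by (auto simp: F_def)
  have "indicator E \<in> X"
    using indicator_mem_L1_Linf[of E M] intersection_embeds assms by auto
  moreover have "rearr M (indicator E) s = rearr M (indicator F) s" for s
    using rearr_indicator_cong assms F by metis
  ultimately have "N (indicator F) = N (indicator E)"
    using rearrangement_invariant[of "indicator E" "indicator F"] F(1) by auto
  then show ?thesis by (simp add: fundamental_def F_def)
qed


definition convexify :: "'a measure \<Rightarrow> real \<Rightarrow> ('a \<Rightarrow> real) set \<Rightarrow> ('a \<Rightarrow> real) set" where
  "convexify M k X = {f \<in> borel_measurable M. (\<lambda>x. \<bar>f x\<bar> powr k) \<in> X}"

definition convexify_norm :: "real \<Rightarrow> (('a \<Rightarrow> real) \<Rightarrow> real) \<Rightarrow> ('a \<Rightarrow> real) \<Rightarrow> real" where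
  "convexify_norm k N f = N (\<lambda>x. \<bar>f x\<bar> powr k) powr (1 / k)"


definition ball_avg :: "'a::metric_space measure \<Rightarrow> real \<Rightarrow> ('a \<Rightarrow> real) \<Rightarrow> 'a \<Rightarrow> real" where
  "ball_avg M s h x = (LINT y:ball x s|M. h y) / measure M (ball x s)"

definition op_norm ::
    "('a \<Rightarrow> real) set \<Rightarrow> (('a \<Rightarrow> real) \<Rightarrow> real) \<Rightarrow> (('a \<Rightarrow> real) \<Rightarrow> 'a \<Rightarrow> real) \<Rightarrow> ennreal" where
  "op_norm Y N T = (SUP h\<in>{h \<in> Y. N h \<le> 1}. ext_norm Y N (T h))"

definition D_const ::
    "'a::metric_space measure \<Rightarrow> ('a \<Rightarrow> real) set \<Rightarrow> (('a \<Rightarrow> real) \<Rightarrow> real) \<Rightarrow> real \<Rightarrow> ennreal" where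
  "D_const M X N p =
     (SUP s\<in>{0<..}. op_norm (convexify M (1 / p) X) (convexify_norm (1 / p) N) (ball_avg M s))"


text \<open>Local integrability means integrability on balls. If \<open>|f|\<^sup>p\<close> is not integrable on some
  \<open>B(x,r)\<close>, then the \<open>p\<close>-oscillation of \<open>f\<close> over \<open>B(y,s)\<close> is infinite for all \<open>y \<in> B(x,r)\<close> and
  \<open>s \<ge> 2r\<close>, so a weaker notion of local integrability would yield the same seminorm.\<close>

definition Lp_loc :: "'a::metric_space measure \<Rightarrow> real \<Rightarrow> ('a \<Rightarrow> real) set" where
  "Lp_loc M p =
     {f \<in> borel_measurable M. \<forall>x r. 0 < r \<longrightarrow> set_integrable M (ball x r) (\<lambda>y. \<bar>f y\<bar> powr p)}"

definition avg_diff :: "'a::metric_space measure \<Rightarrow> real \<Rightarrow> real \<Rightarrow> ('a \<Rightarrow> real) \<Rightarrow> 'a \<Rightarrow> real" where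
  "avg_diff M p r f x =
     ((LINT y:ball x r|M. \<bar>f x - f y\<bar> powr p) / measure M (ball x r)) powr (1 / p)"

definition smoothness_modulus ::
    "'a::metric_space measure \<Rightarrow> ('a \<Rightarrow> real) set \<Rightarrow> (('a \<Rightarrow> real) \<Rightarrow> real) \<Rightarrow>
     real \<Rightarrow> ('a \<Rightarrow> real) \<Rightarrow> real \<Rightarrow> ennreal" where
  "smoothness_modulus M X N p f r = ext_norm X N (avg_diff M p r f)"

definition besov_seminorm ::
    "'a::metric_space measure \<Rightarrow> ('a \<Rightarrow> real) set \<Rightarrow> (('a \<Rightarrow> real) \<Rightarrow> real) \<Rightarrow>
     real \<Rightarrow> real \<Rightarrow> ennreal \<Rightarrow> ('a \<Rightarrow> real) \<Rightarrow> ennreal" where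
  "besov_seminorm M X N \<theta> p q f =
     (if f \<in> Lp_loc M p
      then Lq_dt_over_t q (\<lambda>r. ennreal (r powr (- \<theta>)) * smoothness_modulus M X N p f r)
      else \<infinity>)"

end

theory Submission
  imports Defs "HOL-Real_Asymp.Real_Asymp"
begin

text \<open>For the inequality, put \<open>g = |f|\<^bsup>p\<^sub>0\<^esup>\<close> and \<open>\<lambda> = g\<^sup>*(t)\<close>, and choose \<open>r\<close> comparable to \<open>t\<^sup>1\<^sup>/\<^sup>Q\<close> so that
  every ball of radius \<open>r\<close> has measure at least \<open>2t\<close>. At least half of each ball lies where \<open>g \<le> \<lambda>\<close>, so
  \<open>((g - \<lambda>)\<^sub>+)\<^bsup>1/p\<^sub>0\<^esup>\<close> is pointwise at most a multiple of the averaged oscillation of \<open>f\<close> at scale \<open>r\<close>.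
  On the other hand \<open>\<phi>(t) O(g,t)\<close> is at most the norm of \<open>(g - \<lambda>)\<^sub>+\<close>, in \<open>X\<close> or in \<open>X\<^sup>(\<^sup>1\<^sup>/\<^sup>p\<^sup>)\<close>, by averaging
  over cyclic rearrangements. Substituting \<open>t = a r\<^sup>Q\<close> completes this direction.

  For the converse, test with a Lipschitz cutoff between \<open>B(x,\<rho>)\<close> and \<open>B(x,R)\<close>, where \<open>\<rho>\<close> halves the
  measure of \<open>B(x,R)\<close>. Boundedness of the averaging operators controls its seminorm by the fundamental
  function at \<open>\<mu>(B(x,R))\<close>, whence \<open>R - \<rho> \<le> K \<mu>(B(x,R))\<^sup>1\<^sup>/\<^sup>Q\<close>. Iterating over radii that halve the measure
  gives \<open>R \<le> K' \<mu>(B(x,R))\<^sup>1\<^sup>/\<^sup>Q\<close>.\<close>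

section \<open>The quasi-norm of \<open>L\<^sup>q(dt/t)\<close>\<close>

text \<open>Measurability in r of the integrands built from \<open>smoothness_modulus\<close> is not
  established. For finite q, \<open>Lq_dt_over_t\<close> is therefore handled as a lower integral,
  and each manipulation of it is stated as an inequality in the direction in which it is used. The
  exponent p0 makes |a|^p0 - |b|^p0 at most |a - b|^p0 for every p > 0. If p \<ge> 1, the estimate
  of O(g,t) takes place in X. If p < 1, O carries the power 1/p, which the triangle inequality of X
  does not handle; in X^(1/p), whose fundamental function is phi^p, it appears to the first power,
  and raising the result to 1/p gives the claim in X. In the converse only the monotonicity of phi
  is used: both sides for the cutoff carry the norm of the indicator of B(x,R), which cancels and
  leaves R - \<rho> against mu(B(x,R))^(1/Q). Spheres may carry mass, so halving means that the open
  ball of radius \<rho> has at most half of the measure and the closed ball at least half; the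
  cutoff is 1 on the closed ball.\<close>

lemma epow_ennreal: "0 \<le> x \<Longrightarrow> epow (ennreal x) s = ennreal (x powr s)"
  by (simp add: epow_def)

lemma epow_top [simp]: "epow top s = top"
  by (simp add: epow_def)

lemma epow_mono:
  assumes "a \<le> b" "0 \<le> s"
  shows "epow a s \<le> epow b s"
  using assms by (cases a; cases b) (auto simp: epow_ennreal top_unique intro!: ennreal_leI powr_mono2)

lemma epow_mult:
  assumes "0 \<le> c" "0 < s"
  shows "epow (ennreal c * a) s = ennreal (c powr s) * epow a s"
proof (cases a)
  case (real x)
  then show ?thesis
    using assms by (simp add: epow_ennreal powr_mult flip: ennreal_mult)
next
  case top
  then show ?thesis
    using assms by (cases "c = 0") (auto simp: epow_def ennreal_mult_top)
qed

text \<open>The integral is the supremum over simple functions below \<open>f\<close>, and these are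
  measurable. Bounds for an arbitrary \<open>f\<close> thus reduce to its measurable minorants, to
  which the usual integral rules apply.\<close>

lemma nn_integral_leI_measurable:
  assumes "\<And>g. g \<in> borel_measurable M \<Longrightarrow> (\<And>x. g x \<le> f x) \<Longrightarrow> integral\<^sup>N M g \<le> c"
  shows "integral\<^sup>N M f \<le> c"
  unfolding nn_integral_def
proof (rule SUP_least)
  fix g assume g: "g \<in> {g. simple_function M g \<and> g \<le> f}"
  then have "integral\<^sup>S M g = integral\<^sup>N M g"
    by (simp add: nn_integral_eq_simple_integral)
  also have "\<dots> \<le> c"
    using g by (intro assms) (auto intro: borel_measurable_simple_function simp: le_fun_def)
  finally show "integral\<^sup>S M g \<le> c" .
qed

text \<open>A measurable minorant of \<open>c * f\<close> divided by \<open>c\<close> is a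
  measurable minorant of \<open>f\<close>; hence \<open>f\<close> may be arbitrary.\<close>

lemma nn_integral_cmult_le:
  assumes "0 < c"
  shows "(\<integral>\<^sup>+x. ennreal c * f x \<partial>M) \<le> ennreal c * integral\<^sup>N M f"
proof (rule nn_integral_leI_measurable)
  fix g :: "'a \<Rightarrow> ennreal"
  assume [measurable]: "g \<in> borel_measurable M" and g: "\<And>x. g x \<le> ennreal c * f x"
  have inv: "ennreal (1 / c) * (ennreal c * y) = y" "ennreal c * (ennreal (1 / c) * y) = y" for y
    using assms by (simp_all add: ennreal_mult[symmetric] mult.assoc[symmetric])
  have "integral\<^sup>N M g = (\<integral>\<^sup>+x. ennreal c * (ennreal (1 / c) * g x) \<partial>M)"
    by (simp add: inv)
  also have "\<dots> = ennreal c * (\<integral>\<^sup>+x. ennreal (1 / c) * g x \<partial>M)"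
    by (simp add: nn_integral_cmult)
  also have "\<dots> \<le> ennreal c * integral\<^sup>N M f"
    using mult_left_mono[OF g, of "ennreal (1 / c)"]
    by (intro mult_left_mono nn_integral_mono) (auto simp: inv)
  finally show "integral\<^sup>N M g \<le> ennreal c * integral\<^sup>N M f" .
qed

text \<open>Under t = a r^Q the measure dt/t becomes Q dr/r. The change of variables is carried out
  for a measurable minorant on compact intervals that exhaust the half-line, followed by monotone
  convergence.\<close>

lemma nn_integral_powr_substitution:
  assumes "0 < a" "0 < Q"
  shows "(\<integral>\<^sup>+t\<in>{0<..}. F t / ennreal t \<partial>lborel)
    \<le> ennreal Q * (\<integral>\<^sup>+r\<in>{0<..}. F (a * r powr Q) / ennreal r \<partial>lborel)" (is "?L \<le> ennreal Q * ?R")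
proof (rule nn_integral_leI_measurable)
  fix G :: "real \<Rightarrow> ennreal"
  assume Gm: "G \<in> borel_measurable lborel" and G: "\<And>t. G t \<le> F t / ennreal t * indicator {0<..} t"
  define g where "g = (\<lambda>r. a * r powr Q)"
  define g' where "g' = (\<lambda>r. a * (Q * r powr (Q - 1)))"
  \<comment> \<open>The shift by 2 keeps \<open>lo n < hi n\<close> already at \<open>n = 0\<close>;
    the intervals stay away from 0, where the derivative of the power may be singular.\<close>
  define lo hi :: "nat \<Rightarrow> real" where "lo = (\<lambda>n. 1 / real (n + 2))" and "hi = (\<lambda>n. real (n + 2))"
  have lohi: "0 < lo n" "lo n < hi n" for n
  proof -
    have "1 / real (n + 2) \<le> 1 / 2"
      by (intro divide_left_mono) auto
    moreover have "2 \<le> real (n + 2)" by simp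
    ultimately show "0 < lo n" "lo n < hi n"
      unfolding lo_def hi_def by (simp, linarith)
  qed
  have gmono: "g x \<le> g y" if "0 < x" "x \<le> y" for x y
    using that assms by (auto simp: g_def intro!: powr_mono2)
  have cover: "(SUP n. indicator {g (lo n)..g (hi n)} t) = (indicator {0<..} t :: ennreal)" for t
  proof (cases "t > 0")
    case True
    define u where "u = (t / a) powr (1 / Q)"
    have u: "0 < u" "g u = t"
      using True assms by (auto simp: u_def g_def powr_powr)
    obtain n where n: "max u (1 / u) < real n"
      using reals_Archimedean2 by blast
    have "1 / u \<le> real (n + 2)" "u \<le> hi n"
      using n by (auto simp: hi_def)
    then have "lo n \<le> u" "u \<le> hi n"
      using u by (auto simp: lo_def divide_le_eq mult.commute)
    then have "t \<in> {g (lo n)..g (hi n)}"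
      using u gmono[of "lo n" u] gmono[of u "hi n"] lohi[of n] by auto
    then have "(1::ennreal) \<le> (SUP n. indicator {g (lo n)..g (hi n)} t)"
      by (intro SUP_upper2[of n]) auto
    moreover have "(SUP n. indicator {g (lo n)..g (hi n)} t) \<le> (1::ennreal)"
      by (intro SUP_least) (simp add: indicator_def)
    ultimately have "(SUP n. indicator {g (lo n)..g (hi n)} t) = (1::ennreal)"
      by (rule antisym[rotated])
    then show ?thesis
      using True by simp
  next
    case False
    have "0 < g (lo n)" for n
      using assms lohi[of n] by (simp add: g_def)
    then have "indicator {g (lo n)..g (hi n)} t = (0::ennreal)" for n
      using False by (meson atLeastAtMost_iff indicator_simps(2) le_less_trans less_le_not_le not_less)
    then show ?thesis
      using False by simp
  qed
  have inc: "incseq (\<lambda>n t. G t * indicator {g (lo n)..g (hi n)} t)"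
  proof (rule incseq_SucI, rule le_funI)
    fix n t
    have "lo (Suc n) \<le> lo n" "hi n \<le> hi (Suc n)"
      by (auto simp: lo_def hi_def intro!: divide_left_mono)
    then have "{g (lo n)..g (hi n)} \<subseteq> {g (lo (Suc n))..g (hi (Suc n))}"
      using gmono[of "lo (Suc n)" "lo n"] gmono[of "hi n" "hi (Suc n)"] lohi[of n] lohi[of "Suc n"]
      by (intro atLeastatMost_subset_iff[THEN iffD2]) auto
    then show "G t * indicator {g (lo n)..g (hi n)} t \<le> G t * indicator {g (lo (Suc n))..g (hi (Suc n))} t"
      by (intro mult_left_mono) (auto simp: indicator_def)
  qed
  have "G t = (SUP n. G t * indicator {g (lo n)..g (hi n)} t)" for t
    using G[of t] by (subst SUP_mult_left_ennreal[symmetric], subst cover)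
      (auto simp: indicator_def split: if_splits)
  then have "integral\<^sup>N lborel G = (\<integral>\<^sup>+t. (SUP n. G t * indicator {g (lo n)..g (hi n)} t) \<partial>lborel)"
    by simp
  also have "\<dots> = (SUP n. \<integral>\<^sup>+t. G t * indicator {g (lo n)..g (hi n)} t \<partial>lborel)"
    using Gm by (intro nn_integral_monotone_convergence_SUP inc) auto
  also have "\<dots> \<le> ennreal Q * ?R"
  proof (rule SUP_least)
    fix n
    have "(\<integral>\<^sup>+t. G t * indicator {g (lo n)..g (hi n)} t \<partial>lborel)
        = (\<integral>\<^sup>+r. G (g r) * g' r * indicator {lo n..hi n} r \<partial>lborel)"
    proof (rule nn_integral_substitution_aux)
      show "G \<in> borel_measurable borel" using Gm by simp
      show "(g has_real_derivative g' x) (at x)" if "x \<in> {lo n..hi n}" for x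
        using that lohi[of n] unfolding g_def g'_def
        by (auto intro!: derivative_eq_intros)
      show "continuous_on {lo n..hi n} g'"
        using lohi[of n] unfolding g'_def by (auto intro!: continuous_intros)
    qed (use lohi[of n] assms in \<open>auto simp: g'_def\<close>)
    also have "\<dots> \<le> (\<integral>\<^sup>+r. ennreal Q * (F (a * r powr Q) / ennreal r * indicator {0<..} r) \<partial>lborel)"
    proof (rule nn_integral_mono)
      fix r
      show "G (g r) * g' r * indicator {lo n..hi n} r \<le> ennreal Q * (F (a * r powr Q) / ennreal r * indicator {0<..} r)"
      proof (cases "r \<in> {lo n..hi n}")
        case True
        then have r: "0 < r" using lohi[of n] by auto
        then have gr: "0 < g r" using assms by (simp add: g_def)
        have "G (g r) * g' r \<le> F (g r) / ennreal (g r) * ennreal (g' r)"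
          using G[of "g r"] gr by (intro mult_right_mono) auto
        also have "\<dots> = F (g r) * (ennreal (g' r) / ennreal (g r))"
          by (simp add: divide_ennreal_def mult_ac)
        also have "ennreal (g' r) / ennreal (g r) = ennreal (Q * (1 / r))"
          using r assms gr by (subst divide_ennreal) (auto simp: g'_def g_def powr_diff)
        also have "\<dots> = ennreal Q * inverse (ennreal r)"
          using r assms by (subst ennreal_mult) (auto simp: inverse_ennreal inverse_eq_divide)
        finally show ?thesis
          using r True by (simp add: g_def divide_ennreal_def mult_ac)
      qed auto
    qed
    also have "\<dots> \<le> ennreal Q * ?R"
      by (rule nn_integral_cmult_le) fact
    finally show "(\<integral>\<^sup>+t. G t * indicator {g (lo n)..g (hi n)} t \<partial>lborel) \<le> ennreal Q * ?R" .
  qed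
  finally show "integral\<^sup>N lborel G \<le> ennreal Q * ?R" .
qed

lemma Lq_mono:
  assumes "\<And>t. 0 < t \<Longrightarrow> F t \<le> G t"
  shows "Lq_dt_over_t q F \<le> Lq_dt_over_t q G"
proof (cases "q = \<infinity>")
  case False
  have "epow (F t) (enn2real q) / ennreal t * indicator {0<..} t
     \<le> epow (G t) (enn2real q) / ennreal t * indicator {0<..} t" for t
    using assms by (cases "t > 0") (auto intro!: divide_right_mono_ennreal epow_mono)
  then show ?thesis
    using False unfolding Lq_dt_over_t_def by (auto intro!: epow_mono nn_integral_mono)
qed (use assms in \<open>auto simp: Lq_dt_over_t_def intro!: SUP_mono\<close>)

lemma Lq_cmult_le:
  assumes "0 < c" "0 < q"
  shows "Lq_dt_over_t q (\<lambda>t. ennreal c * F t) \<le> ennreal c * Lq_dt_over_t q F"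
proof (cases "q = \<infinity>")
  case True
  then show ?thesis
    by (auto simp: Lq_dt_over_t_def intro!: SUP_least mult_left_mono SUP_upper)
next
  case False
  define s where "s = enn2real q"
  have s: "0 < s"
    using assms False by (simp add: s_def enn2real_positive_iff less_top)
  have "(\<integral>\<^sup>+t\<in>{0<..}. epow (ennreal c * F t) s / ennreal t \<partial>lborel)
      = (\<integral>\<^sup>+t. ennreal (c powr s) * (epow (F t) s / ennreal t * indicator {0<..} t) \<partial>lborel)"
    using assms s by (simp add: epow_mult divide_ennreal_def mult_ac)
  also have "\<dots> \<le> ennreal (c powr s) * (\<integral>\<^sup>+t\<in>{0<..}. epow (F t) s / ennreal t \<partial>lborel)" (is "_ \<le> _ * ?I")
    using assms by (intro nn_integral_cmult_le) auto
  finally have "Lq_dt_over_t q (\<lambda>t. ennreal c * F t) \<le> epow (ennreal (c powr s) * ?I) (1 / s)"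
    using False s by (auto simp: Lq_dt_over_t_def s_def intro!: epow_mono)
  also have "\<dots> = ennreal c * epow ?I (1 / s)"
    using s assms by (simp add: epow_mult powr_powr)
  finally show ?thesis
    using False by (simp add: Lq_dt_over_t_def s_def)
qed

text \<open>The constant is Q^(1/q), or 1 for q = \<infinity>. It does not depend on
  \<open>a\<close> because dt/t is invariant under dilations.\<close>

lemma Lq_substitution:
  assumes "0 < Q" "0 < q"
  obtains K :: real where "0 < K"
    "\<And>a F. 0 < a \<Longrightarrow> Lq_dt_over_t q F \<le> ennreal K * Lq_dt_over_t q (\<lambda>r. F (a * r powr Q))"
proof (cases "q = \<infinity>")
  case True
  have "Lq_dt_over_t q F \<le> ennreal 1 * Lq_dt_over_t q (\<lambda>r. F (a * r powr Q))" if "0 < a" for a F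
  proof -
    have "F t \<le> (SUP r\<in>{0<..}. F (a * r powr Q))" if "0 < t" for t
      using that \<open>0 < a\<close> \<open>0 < Q\<close> by (intro SUP_upper2[of "(t / a) powr (1 / Q)"]) (auto simp: powr_powr)
    then show ?thesis
      using True by (auto simp: Lq_dt_over_t_def intro!: SUP_least)
  qed
  then show ?thesis by (intro that[of 1]) auto
next
  case False
  define s where "s = enn2real q"
  have s: "0 < s"
    using assms False by (simp add: s_def enn2real_positive_iff less_top)
  have "Lq_dt_over_t q F \<le> ennreal (Q powr (1 / s)) * Lq_dt_over_t q (\<lambda>r. F (a * r powr Q))" if "0 < a" for a F
  proof -
    have "Lq_dt_over_t q F
      \<le> epow (ennreal Q * (\<integral>\<^sup>+r\<in>{0<..}. epow (F (a * r powr Q)) s / ennreal r \<partial>lborel)) (1 / s)"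
      using False s nn_integral_powr_substitution[OF that assms(1), of "\<lambda>t. epow (F t) s"]
      by (auto simp: Lq_dt_over_t_def s_def intro!: epow_mono)
    also have "\<dots> = ennreal (Q powr (1 / s)) * Lq_dt_over_t q (\<lambda>r. F (a * r powr Q))"
      using False s assms by (simp add: Lq_dt_over_t_def epow_mult flip: s_def)
    finally show ?thesis .
  qed
  then show ?thesis using assms by (intro that[of "Q powr (1 / s)"]) auto
qed

section \<open>Decreasing rearrangements\<close>

lemma rearr_le:
  assumes "0 \<le> l" "emeasure M {x \<in> space M. l < \<bar>f x\<bar>} \<le> ennreal t"
  shows "rearr M f t \<le> ennreal l"
  unfolding rearr_def using assms by (intro Inf_lower) auto

lemma rearr_ge:
  assumes "\<And>l. 0 \<le> l \<Longrightarrow> l < a \<Longrightarrow> ennreal t < emeasure M {x \<in> space M. l < \<bar>f x\<bar>}"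
  shows "ennreal a \<le> rearr M f t"
  unfolding rearr_def
proof (rule Inf_greatest)
  fix z assume "z \<in> {ennreal l |l. 0 \<le> l \<and> emeasure M {x \<in> space M. l < \<bar>f x\<bar>} \<le> ennreal t}"
  then obtain l where "z = ennreal l" "0 \<le> l" "emeasure M {x \<in> space M. l < \<bar>f x\<bar>} \<le> ennreal t"
    by auto
  then have "a \<le> l"
    using assms[of l] by (meson leD not_le)
  then show "ennreal a \<le> z"
    using \<open>z = ennreal l\<close> by (simp add: ennreal_leI)
qed

lemma less_rearrD:
  assumes "ennreal l < rearr M f t" "0 \<le> l"
  shows "ennreal t < emeasure M {x \<in> space M. l < \<bar>f x\<bar>}"
  using rearr_le[of l M f t] assms by (meson leD not_le)

lemma rearr_antimono:
  assumes "s \<le> t"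
  shows "rearr M f t \<le> rearr M f s"
  unfolding rearr_def using ennreal_leI[OF assms] by (intro Inf_superset_mono) (auto intro: order_trans)

lemma rearr_measurable [measurable]: "rearr M f \<in> borel_measurable borel"
proof (rule borel_measurableI_le)
  fix y
  have "is_interval {x. rearr M f x \<le> y}"
    unfolding is_interval_1 mem_Collect_eq using order_trans[OF rearr_antimono[of _ _ M f]] by blast
  then show "{x \<in> space borel. rearr M f x \<le> y} \<in> sets borel"
    by (simp add: real_interval_borel_measurable)
qed

text \<open>The infimum defining the rearrangement is attained: the strict superlevel set at
  \<open>l\<close> is the increasing union of those at levels slightly above \<open>l\<close>, and
  the measure is continuous from below.\<close>

lemma emeasure_gt_rearr_le:
  assumes [measurable]: "f \<in> borel_measurable M" and "rearr M f t = ennreal l" "0 \<le> l"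
  shows "emeasure M {x \<in> space M. l < \<bar>f x\<bar>} \<le> ennreal t"
proof -
  define A where "A = (\<lambda>n. {x \<in> space M. l + 1 / real (Suc n) < \<bar>f x\<bar>})"
  have [measurable]: "A n \<in> sets M" for n
    unfolding A_def by measurable
  have "A m \<subseteq> A n" if "m \<le> n" for m n
  proof -
    have "1 / real (Suc n) \<le> 1 / real (Suc m)"
      using that by (intro divide_left_mono) auto
    then show ?thesis by (auto simp: A_def)
  qed
  then have inc: "incseq A"
    by (auto simp: incseq_def)
  have "{x \<in> space M. l < \<bar>f x\<bar>} = (\<Union>n. A n)"
  proof (intro equalityI subsetI)
    fix x assume "x \<in> {x \<in> space M. l < \<bar>f x\<bar>}"
    then have x: "x \<in> space M" "0 < \<bar>f x\<bar> - l" by auto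
    then obtain n where "1 / real (Suc n) < \<bar>f x\<bar> - l"
      using nat_approx_posE by metis
    then show "x \<in> (\<Union>n. A n)"
      using x by (auto simp: A_def intro!: exI[of _ n])
  next
    fix x assume "x \<in> (\<Union>n. A n)"
    then obtain n where "x \<in> space M" "l + 1 / real (Suc n) < \<bar>f x\<bar>" by (auto simp: A_def)
    moreover have "0 < 1 / real (Suc n)" by simp
    ultimately show "x \<in> {x \<in> space M. l < \<bar>f x\<bar>}" 
      unfolding mem_Collect_eq by linarith
  qed
  also have "emeasure M (\<Union>n. A n) = (SUP n. emeasure M (A n))"
    using inc by (intro SUP_emeasure_incseq[symmetric]) auto
  also have "\<dots> \<le> ennreal t"
  proof (rule SUP_least)
    fix n
    have "rearr M f t < ennreal (l + 1 / real (Suc n))"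
      using assms by (auto intro!: ennreal_lessI)
    then obtain l' where l': "ennreal l' < ennreal (l + 1 / real (Suc n))" "0 \<le> l'"
        "emeasure M {x \<in> space M. l' < \<bar>f x\<bar>} \<le> ennreal t"
      unfolding rearr_def Inf_less_iff by auto
    then have "l' < l + 1 / real (Suc n)"
      by (simp add: ennreal_less_iff)
    then have "emeasure M (A n) \<le> emeasure M {x \<in> space M. l' < \<bar>f x\<bar>}"
      by (intro emeasure_mono) (auto simp: A_def)
    with l' show "emeasure M (A n) \<le> ennreal t" by simp
  qed
  finally show ?thesis .
qed

text \<open>Where |f| exceeds \<open>b + c\<close>, with \<open>b\<close> bounding the bounded part,
  the integrable part exceeds \<open>c\<close>; Markov's inequality bounds the measure of that
  set.\<close>

lemma rearr_finite:
  assumes "f \<in> L1_plus_Linf M" "0 < t"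
  shows "rearr M f t < \<infinity>"
proof -
  obtain g h where gh: "g \<in> L1 M" "h \<in> Linf M" and f: "f = (\<lambda>x. g x + h x)"
    using assms by (auto simp: L1_plus_Linf_def)
  have [measurable]: "g \<in> borel_measurable M" "h \<in> borel_measurable M"
    using gh by (auto simp: L1_def Linf_def)
  obtain a where a: "L1_norm M g = ennreal a" "0 \<le> a"
    using gh by (cases "L1_norm M g") (auto simp: L1_def)
  obtain b where b: "Linf_norm M h = ennreal b" "0 \<le> b"
    using gh by (cases "Linf_norm M h") (auto simp: Linf_def)
  \<comment> \<open>Chosen so that the Markov bound \<open>a / c\<close> is at most
    \<open>t\<close>; the \<open>+ 1\<close> keeps \<open>c\<close> positive when
    \<open>a = 0\<close>.\<close>
  define c where "c = (a + 1) / t"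
  have c: "0 < c" using a assms by (simp add: c_def)
  have "AE x in M. ennreal \<bar>h x\<bar> \<le> ennreal b"
    using esssup_AE[of "\<lambda>x. ennreal \<bar>h x\<bar>" M] b by (simp add: Linf_norm_def)
  then have ae: "AE x in M. \<bar>h x\<bar> \<le> b"
    by eventually_elim (use b in auto)
  have "emeasure M {x \<in> space M. b + c < \<bar>f x\<bar>} \<le> emeasure M {x \<in> space M. 1 \<le> ennreal (1 / c) * ennreal \<bar>g x\<bar>}"
  proof (rule emeasure_mono_AE)
    show "AE x in M. x \<in> {x \<in> space M. b + c < \<bar>f x\<bar>} \<longrightarrow> x \<in> {x \<in> space M. 1 \<le> ennreal (1 / c) * ennreal \<bar>g x\<bar>}"
      using ae
    proof eventually_elim
      case (elim x)
      have "1 \<le> ennreal (1 / c) * ennreal \<bar>g x\<bar>" if "b + c < \<bar>f x\<bar>"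
      proof -
        have "1 \<le> 1 / c * \<bar>g x\<bar>"
          using c that elim by (simp add: f field_simps)
        then show ?thesis
          using c by (subst ennreal_mult[symmetric]) auto
      qed
      then show ?case by auto
    qed
  qed measurable
  also have "\<dots> \<le> ennreal (1 / c) * (\<integral>\<^sup>+x. ennreal \<bar>g x\<bar> * indicator (space M) x \<partial>M)"
    by (intro nn_integral_Markov_inequality) auto
  also have "(\<integral>\<^sup>+x. ennreal \<bar>g x\<bar> * indicator (space M) x \<partial>M) = ennreal a"
    using a by (simp add: L1_norm_def cong: nn_integral_cong_simp)
  also have "ennreal (1 / c) * ennreal a \<le> ennreal t"
    using a c assms by (subst ennreal_mult[symmetric]) (auto simp: c_def intro!: ennreal_leI simp: field_simps)
  finally have "rearr M f t \<le> ennreal (b + c)"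
    using b c by (intro rearr_le) auto
  then show ?thesis
    by (rule le_less_trans) simp
qed

section \<open>Sets of prescribed measure\<close>

context metric_measure_space
begin

lemma space_UNIV: "space M = UNIV"
  using sets_eq_imp_space_eq[OF borel_measure] by simp

lemma ball_sets [measurable]: "ball x r \<in> sets M"
  using borel_measure by simp

lemma emeasure_ball:
  assumes "0 < r"
  shows "emeasure M (ball x r) = ennreal (measure M (ball x r))" "0 < measure M (ball x r)"
proof -
  show *: "emeasure M (ball x r) = ennreal (measure M (ball x r))"
    using ball_finite[OF assms, of x] by (intro emeasure_eq_ennreal_measure) auto
  show "0 < measure M (ball x r)"
    using ball_positive[OF assms, of x] unfolding * by simp
qed

lemma UN_ball: "(\<Union>n. ball x (real (Suc n))) = UNIV"
proof -
  have "\<exists>n. dist x y < real (Suc n)" for y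
    using reals_Archimedean2[of "dist x y"] by (metis lessI less_trans of_nat_less_iff)
  then show ?thesis by auto
qed

lemma sigma_finite: "sigma_finite_measure M"
proof
  obtain x :: 'a where True by simp
  show "\<exists>A. countable A \<and> A \<subseteq> sets M \<and> \<Union>A = space M \<and> (\<forall>a\<in>A. emeasure M a \<noteq> \<infinity>)"
    using UN_ball[of x] ball_finite[of _ x]
    by (intro exI[of _ "range (\<lambda>n. ball x (real (Suc n)))"]) (auto simp: space_UNIV less_top)
qed

text \<open>Nonatomicity yields only some strictly smaller piece of positive measure. Either that
  piece or its complement in the set has at most half of the measure, and this choice is
  iterated.\<close>

lemma small_subset:
  assumes "A \<in> sets M" "0 < emeasure M A" "emeasure M A < \<infinity>" "0 < e"
  obtains B where "B \<in> sets M" "B \<subseteq> A" "0 < measure M B" "measure M B \<le> e"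
proof -
  have fin: "emeasure M B = ennreal (measure M B)" if "B \<in> sets M" "B \<subseteq> A" for B
    using emeasure_mono[OF that(2) assms(1)] assms(3) by (intro emeasure_eq_ennreal_measure) auto
  have halve: "\<exists>C\<in>sets M. C \<subseteq> B \<and> 0 < measure M C \<and> measure M C \<le> measure M B / 2"
    if B: "B \<in> sets M" "B \<subseteq> A" "0 < measure M B" for B
  proof -
    have "0 < emeasure M B" using B fin by simp
    then obtain C where C: "C \<in> sets M" "C \<subseteq> B" "0 < emeasure M C" "emeasure M C < emeasure M B"
      using nonatomic[OF B(1)] by auto
    have "0 < measure M C" "measure M C < measure M B"
      using C fin[of B] fin[of C] B by (auto simp: ennreal_less_iff)
    moreover have "measure M (B - C) = measure M B - measure M C"
      using C B fin[of B] by (intro measure_Diff) auto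
    moreover have "C \<in> sets M" "C \<subseteq> B" "B - C \<in> sets M" "B - C \<subseteq> B"
      using C B by auto
    ultimately show ?thesis
    proof (cases "measure M C \<le> measure M B / 2")
      case True
      then show ?thesis
        using \<open>C \<in> sets M\<close> \<open>C \<subseteq> B\<close> \<open>0 < measure M C\<close> by blast
    next
      case False
      then have "measure M (B - C) \<le> measure M B / 2" "0 < measure M (B - C)"
        using \<open>measure M (B - C) = measure M B - measure M C\<close> \<open>measure M C < measure M B\<close> by auto
      then show ?thesis
        using \<open>B - C \<in> sets M\<close> \<open>B - C \<subseteq> B\<close> by blast
    qed
  qed
  have "\<exists>B\<in>sets M. B \<subseteq> A \<and> 0 < measure M B \<and> measure M B \<le> measure M A / 2 ^ n" for n
  proof (induction n)
    case 0
    then show ?case using assms fin[of A] by (auto intro!: bexI[of _ A])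
  next
    case (Suc n)
    then obtain B where B: "B \<in> sets M" "B \<subseteq> A" "0 < measure M B" "measure M B \<le> measure M A / 2 ^ n"
      by auto
    with halve[of B] obtain C where "C \<in> sets M" "C \<subseteq> B" "0 < measure M C" "measure M C \<le> measure M B / 2"
      by auto
    moreover have "measure M B / 2 \<le> measure M A / 2 ^ Suc n"
      using B by simp
    ultimately show ?case using B by (intro bexI[of _ C]) auto
  qed
  moreover obtain n where "measure M A / e < 2 ^ n"
    using real_arch_pow[of 2] by auto
  ultimately obtain B where B: "B \<in> sets M" "B \<subseteq> A" "0 < measure M B" "measure M B \<le> measure M A / 2 ^ n"
    by blast
  have "measure M A / 2 ^ n \<le> e"
    using \<open>measure M A / e < 2 ^ n\<close> assms by (simp add: field_simps)
  with B show ?thesis by (intro that) auto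
qed

text \<open>Greedy exhaustion: sets of measure at most \<open>s\<close> are enlarged step by step.
  If their union fell short of \<open>s\<close>, a small piece of the rest could have been added at
  every stage, so the increments could not tend to 0.\<close>

lemma sierpinski:
  assumes A: "A \<in> sets M" "emeasure M A < \<infinity>" and s: "0 \<le> s" "s \<le> measure M A"
  obtains B where "B \<in> sets M" "B \<subseteq> A" "measure M B = s"
proof -
  define P where "P = (\<lambda>B. B \<in> sets M \<and> B \<subseteq> A \<and> measure M B \<le> s)"
  have fin: "emeasure M B \<noteq> \<infinity>" if "B \<subseteq> A" for B
    using emeasure_mono[OF that A(1)] A(2) by (auto simp: top_unique)
  \<comment> \<open>The greedy rule: the passage from \<open>B\<close> to \<open>B'\<close> gains at
    least half of what any admissible extension would add.\<close>
  define R where "R = (\<lambda>B B'. B \<subseteq> B' \<and>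
    (\<forall>C\<in>sets M. C \<subseteq> A - B \<longrightarrow> measure M B + measure M C \<le> s \<longrightarrow> measure M C \<le> 2 * (measure M B' - measure M B)))"
  have step: "\<exists>B'. P B' \<and> R B B'" if "P B" for B
  proof -
    define V where "V = {measure M C | C. C \<in> sets M \<and> C \<subseteq> A - B \<and> measure M B + measure M C \<le> s}"
    have V0: "0 \<in> V" using that by (auto simp: V_def P_def intro!: exI[of _ "{}"])
    have "v \<le> s" if v: "v \<in> V" for v
    proof -
      have "measure M B + v \<le> s" using v by (auto simp: V_def)
      moreover have "0 \<le> measure M B" by simp
      ultimately show ?thesis by linarith
    qed
    then have bdd: "bdd_above V" by (auto simp: bdd_above_def)
    show ?thesis
    proof (cases "Sup V = 0")
      case True
      then have "v \<le> 0" if "v \<in> V" for v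
        using cSup_upper[OF that bdd] by simp
      then have "measure M C \<le> 0" if "C \<in> sets M" "C \<subseteq> A - B" "measure M B + measure M C \<le> s" for C
        using that unfolding V_def by blast
      then show ?thesis using that by (auto simp: R_def)
    next
      case False
      then have "0 < Sup V" using cSup_upper[OF V0 bdd] by simp
      then obtain v where v: "v \<in> V" "Sup V / 2 < v"
        using less_cSup_iff[of V "Sup V / 2"] V0 bdd by auto
      then obtain C where C: "v = measure M C" "C \<in> sets M" "C \<subseteq> A - B" "measure M B + measure M C \<le> s"
        by (auto simp: V_def)
      have "B \<in> sets M" "B \<subseteq> A" "C \<subseteq> A" "B \<inter> C = {}"
        using C that by (auto simp: P_def)
      then have BC: "measure M (B \<union> C) = measure M B + measure M C"
        using C fin by (intro measure_Union) auto
      have "measure M D \<le> 2 * measure M C" if "D \<in> sets M" "D \<subseteq> A - B" "measure M B + measure M D \<le> s" for D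
      proof -
        have "measure M D \<le> Sup V"
          using that by (intro cSup_upper bdd) (auto simp: V_def)
        then show ?thesis using v C by simp
      qed
      then show ?thesis
        using C that BC by (intro exI[of _ "B \<union> C"]) (auto simp: P_def R_def)
    qed
  qed
  have "\<exists>F. \<forall>n. P (F n) \<and> R (F n) (F (Suc n))"
  proof (rule dependent_nat_choice)
    show "\<exists>B. P B" using s by (intro exI[of _ "{}"]) (auto simp: P_def)
  qed (rule step)
  then obtain F where F: "\<And>n. P (F n)" "\<And>n. R (F n) (F (Suc n))" by blast
  have inc: "incseq F" using F(2) by (auto simp: R_def intro: incseq_SucI)
  define B where "B = (\<Union>n. F n)"
  have B: "B \<in> sets M" "B \<subseteq> A" using F by (auto simp: B_def P_def)
  have lim: "(\<lambda>n. measure M (F n)) \<longlonglongrightarrow> measure M B"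
    unfolding B_def using F fin[OF B(2)] by (intro Lim_measure_incseq inc) (auto simp: P_def B_def)
  then have le: "measure M B \<le> s"
    using F by (intro LIMSEQ_le_const2[OF lim]) (auto simp: P_def)
  have "measure M B = s"
  proof (rule ccontr)
    assume "measure M B \<noteq> s"
    with le have less: "measure M B < s" by simp
    have "emeasure M (A - B) = ennreal (measure M (A - B))"
      using fin[of "A - B"] by (intro emeasure_eq_ennreal_measure) auto
    moreover have "measure M (A - B) = measure M A - measure M B"
      using fin[of B] A B by (intro measure_Diff) auto
    ultimately obtain C where C: "C \<in> sets M" "C \<subseteq> A - B" "0 < measure M C" "measure M C \<le> s - measure M B"
      using small_subset[of "A - B" "s - measure M B"] less s A B by (auto simp: less_top)
    \<comment> \<open>\<open>C\<close> is admissible at every stage, so each increment is at least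
      half of its measure; the increments of a convergent sequence tend to 0.\<close>
    have "measure M C \<le> 2 * (measure M (F (Suc n)) - measure M (F n))" for n
    proof -
      have "F n \<subseteq> B" by (auto simp: B_def)
      then have "C \<subseteq> A - F n" using C by auto
      moreover have "measure M (F n) \<le> measure M B"
        using \<open>F n \<subseteq> B\<close> F(1)[of n] fin[OF B(2)] B
        by (intro measure_mono_fmeasurable fmeasurableI) (auto simp: P_def less_top)
      ultimately show ?thesis
        using F(2)[of n] C unfolding R_def by auto
    qed
    moreover have "(\<lambda>n. 2 * (measure M (F (Suc n)) - measure M (F n))) \<longlonglongrightarrow> 2 * (measure M B - measure M B)"
      by (intro tendsto_intros lim LIMSEQ_Suc)
    ultimately have "measure M C \<le> 2 * (measure M B - measure M B)"
      by (intro LIMSEQ_le_const) auto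
    with C show False by simp
  qed
  with B show ?thesis by (intro that)
qed

text \<open>\<open>sierpinski\<close> is applied to the part of \<open>A\<close> outside
  \<open>F\<close>. An \<open>A\<close> of infinite measure is first cut down to the union of
  \<open>F\<close> with its trace on a large ball.\<close>

lemma exists_intermediate_set:
  assumes "F \<in> sets M" "A \<in> sets M" "F \<subseteq> A" "emeasure M F \<le> ennreal s" "ennreal s \<le> emeasure M A" "0 \<le> s"
  obtains G where "G \<in> sets M" "F \<subseteq> G" "G \<subseteq> A" "emeasure M G = ennreal s"
proof -
  obtain A' where A': "A' \<in> sets M" "F \<subseteq> A'" "A' \<subseteq> A" "emeasure M A' < \<infinity>" "ennreal s \<le> emeasure M A'"
  proof (cases "emeasure M A = \<infinity>")
    case False
    then show ?thesis using assms that[of A] by (auto simp: less_top)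
  next
    case True
    obtain x :: 'a where True by simp
    define B where "B = (\<lambda>n. F \<union> (A \<inter> ball x (real (Suc n))))"
    have [measurable]: "B n \<in> sets M" for n using assms by (auto simp: B_def)
    have inc: "incseq B"
      by (auto simp: B_def incseq_def intro: order_less_le_trans)
    have "(\<Union>n. B n) = F \<union> (A \<inter> (\<Union>n. ball x (real (Suc n))))"
      by (auto simp: B_def)
    then have "(\<Union>n. B n) = A"
      using assms unfolding UN_ball by auto
    moreover have "(SUP n. emeasure M (B n)) = emeasure M (\<Union>n. B n)"
      using inc by (intro SUP_emeasure_incseq) auto
    ultimately have "(SUP n. emeasure M (B n)) = \<infinity>"
      using \<open>emeasure M A = \<infinity>\<close> by simp
    then have "ennreal s < (SUP n. emeasure M (B n))" by (simp only: infinity_ennreal_def ennreal_less_top)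
    then obtain n where n: "ennreal s < emeasure M (B n)"
      by (auto simp: less_SUP_iff)
    have "emeasure M (B n) \<le> emeasure M F + emeasure M (A \<inter> ball x (real (Suc n)))"
      unfolding B_def using assms by (intro emeasure_subadditive) auto
    also have "\<dots> \<le> ennreal s + emeasure M (ball x (real (Suc n)))"
      using assms by (intro add_mono emeasure_mono) auto
    also have "\<dots> < \<infinity>"
      using ball_finite[of "real (Suc n)" x] by simp
    finally show ?thesis
      using n assms by (intro that[of "B n"]) (auto simp: B_def)
  qed
  have F: "emeasure M F = ennreal (measure M F)"
    using assms by (intro emeasure_eq_ennreal_measure) (auto simp: top_unique)
  have A'm: "emeasure M A' = ennreal (measure M A')"
    using A' by (intro emeasure_eq_ennreal_measure) auto
  have d: "measure M (A' - F) = measure M A' - measure M F"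
    using A' assms by (intro measure_Diff) auto
  have "measure M F \<le> s" "s \<le> measure M A'"
    using assms A' F A'm by (auto simp: ennreal_le_iff2)
  moreover have "emeasure M (A' - F) < \<infinity>"
    using emeasure_mono[of "A' - F" A' M] A' by (auto intro: le_less_trans)
  ultimately obtain B where B: "B \<in> sets M" "B \<subseteq> A' - F" "measure M B = s - measure M F"
    using sierpinski[of "A' - F" "s - measure M F"] A' assms d by auto
  have "emeasure M B \<le> emeasure M A'"
    using B A' by (intro emeasure_mono) auto
  then have "emeasure M B \<noteq> \<infinity>"
    using A' by (auto simp: top_unique)
  then have "emeasure M B = ennreal (s - measure M F)"
    using B by (simp add: emeasure_eq_ennreal_measure)
  then have "emeasure M (F \<union> B) = ennreal s"
    using B assms F \<open>measure M F \<le> s\<close> by (subst plus_emeasure[symmetric]) (auto simp flip: ennreal_plus)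
  then show ?thesis
    using B A' assms by (intro that[of "F \<union> B"]) auto
qed

lemma emeasure_singleton: "emeasure M {x} = 0"
proof (rule ccontr)
  assume "emeasure M {x} \<noteq> 0"
  then obtain B where "B \<in> sets M" "B \<subseteq> {x}" "0 < emeasure M B" "emeasure M B < emeasure M {x}"
    using nonatomic[of "{x}"] borel_measure by (auto simp: zero_less_iff_neq_zero)
  then show False by (auto simp: subset_singleton_iff)
qed

end

section \<open>Averages of step functions in r.i. spaces\<close>

text \<open>For superlevel sets \<open>A i\<close>, the layers \<open>F (Suc i) - F i\<close> are
  disjoint, have measure \<open>\<tau>\<close> and lie where the function reaches the i-th level.
  They carry a step function below the given one, and ties on level sets of positive measure do no
  harm.\<close>

lemma (in metric_measure_space) exists_chain:
  assumes A: "\<And>i. A i \<in> sets M" "\<And>i. A i \<subseteq> A (Suc i)" "\<And>i. ennreal (real (Suc i) * \<tau>) \<le> emeasure M (A i)"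
    and "0 \<le> \<tau>"
  obtains F :: "nat \<Rightarrow> 'a set" where "F 0 = {}" "\<And>i. F i \<in> sets M" "\<And>i. F i \<subseteq> F (Suc i)"
    "\<And>i. F (Suc i) \<subseteq> A i" "\<And>i. emeasure M (F i) = ennreal (real i * \<tau>)"
proof -
  define P where "P = (\<lambda>n F. F \<in> sets M \<and> F \<subseteq> A n \<and> emeasure M F = ennreal (real n * \<tau>) \<and> (n = 0 \<longrightarrow> F = {}))"
  define R where "R = (\<lambda>n F F'. F \<subseteq> F' \<and> F' \<subseteq> A n)"
  have "\<exists>F. \<forall>n. P n (F n) \<and> R n (F n) (F (Suc n))"
  proof (rule dependent_nat_choice)
    show "\<exists>F. P 0 F" by (auto simp: P_def)
  next
    fix F n assume P: "P n F"
    have "ennreal (real n * \<tau>) \<le> ennreal (real (Suc n) * \<tau>)"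
      using assms by (intro ennreal_leI mult_right_mono) auto
    then have F: "F \<in> sets M" "F \<subseteq> A n" "emeasure M F \<le> ennreal (real (Suc n) * \<tau>)"
      using P by (auto simp: P_def)
    have "0 \<le> real (Suc n) * \<tau>" using assms by simp
    then obtain G where "G \<in> sets M" "F \<subseteq> G" "G \<subseteq> A n" "emeasure M G = ennreal (real (Suc n) * \<tau>)"
      using exists_intermediate_set[OF F(1) A(1)[of n] F(2,3) A(3)[of n]] by metis
    then show "\<exists>F'. P (Suc n) F' \<and> R n F F'"
      using A(2)[of n] unfolding P_def R_def by blast
  qed
  then obtain F where "\<And>n. P n (F n)" "\<And>n. R n (F n) (F (Suc n))" by blast
  then show ?thesis
    by (intro that[of F]) (auto simp: P_def R_def)
qed

lemma sum_indicator_disjoint: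
  fixes c :: "'i \<Rightarrow> real"
  assumes "disjoint_family_on E I" "finite I" "i \<in> I" "x \<in> E i"
  shows "(\<Sum>j\<in>I. c j * indicator (E j) x) = c i"
proof -
  have "(\<Sum>j\<in>I. c j * indicator (E j) x) = (\<Sum>j\<in>I. if j = i then c i else 0)"
    using assms by (intro sum.cong) (auto simp: disjoint_family_on_def indicator_def)
  then show ?thesis using assms by simp
qed

lemma emeasure_step_function:
  fixes c :: "'i \<Rightarrow> real"
  assumes E: "disjoint_family_on E I" "finite I" "\<And>i. i \<in> I \<Longrightarrow> E i \<in> sets M"
    "\<And>i. i \<in> I \<Longrightarrow> emeasure M (E i) = \<tau>" and "0 \<le> l"
  shows "emeasure M {x \<in> space M. l < \<bar>\<Sum>j\<in>I. c j * indicator (E j) x\<bar>} = of_nat (card {i\<in>I. l < \<bar>c i\<bar>}) * \<tau>"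
proof -
  have "{x \<in> space M. l < \<bar>\<Sum>j\<in>I. c j * indicator (E j) x\<bar>} = (\<Union>i\<in>{i\<in>I. l < \<bar>c i\<bar>}. E i)"
  proof (intro equalityI subsetI)
    fix x assume x: "x \<in> {x \<in> space M. l < \<bar>\<Sum>j\<in>I. c j * indicator (E j) x\<bar>}"
    then have "(\<Sum>j\<in>I. c j * indicator (E j) x) \<noteq> 0" using \<open>0 \<le> l\<close> by auto
    then obtain i where "i \<in> I" "x \<in> E i"
      by (metis (mono_tags, lifting) indicator_simps(2) mult_zero_right sum.neutral)
    then show "x \<in> (\<Union>i\<in>{i\<in>I. l < \<bar>c i\<bar>}. E i)"
      using x sum_indicator_disjoint[OF E(1,2), of i x c] by auto
  next
    fix x assume "x \<in> (\<Union>i\<in>{i\<in>I. l < \<bar>c i\<bar>}. E i)"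
    then obtain i where "i \<in> I" "l < \<bar>c i\<bar>" "x \<in> E i" by auto
    then show "x \<in> {x \<in> space M. l < \<bar>\<Sum>j\<in>I. c j * indicator (E j) x\<bar>}"
      using sum_indicator_disjoint[OF E(1,2), of i x c] sets.sets_into_space[OF E(3)[of i]] by auto
  qed
  also have "emeasure M \<dots> = (\<Sum>i\<in>{i\<in>I. l < \<bar>c i\<bar>}. emeasure M (E i))"
    using E by (intro sum_emeasure[symmetric]) (auto intro: disjoint_family_on_mono[OF _ E(1)])
  also have "\<dots> = of_nat (card {i\<in>I. l < \<bar>c i\<bar>}) * \<tau>"
    using E by simp
  finally show ?thesis .
qed

text \<open>All pieces have the same measure, so the distribution function only counts the
  coefficients above a level, and a permutation preserves the count.\<close>

lemma rearr_step_function_permute: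
  fixes c :: "'i \<Rightarrow> real"
  assumes E: "disjoint_family_on E I" "finite I" "\<And>i. i \<in> I \<Longrightarrow> E i \<in> sets M"
    "\<And>i. i \<in> I \<Longrightarrow> emeasure M (E i) = \<tau>" and \<sigma>: "bij_betw \<sigma> I I"
  shows "rearr M (\<lambda>x. \<Sum>j\<in>I. c (\<sigma> j) * indicator (E j) x) t = rearr M (\<lambda>x. \<Sum>j\<in>I. c j * indicator (E j) x) t"
proof -
  have "bij_betw \<sigma> {i\<in>I. l < \<bar>c (\<sigma> i)\<bar>} {i\<in>I. l < \<bar>c i\<bar>}" for l
    using \<sigma> by (auto simp: bij_betw_def inj_on_def image_iff)
  then have "card {i\<in>I. l < \<bar>c (\<sigma> i)\<bar>} = card {i\<in>I. l < \<bar>c i\<bar>}" for l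
    by (rule bij_betw_same_card)
  then show ?thesis
    unfolding rearr_def using emeasure_step_function[OF E, of _ c] emeasure_step_function[OF E, of _ "\<lambda>i. c (\<sigma> i)"]
    by (intro arg_cong[where f = Inf]) (auto cong: conj_cong)
qed

lemma bij_betw_add_mod:
  assumes "0 < (n::nat)"
  shows "bij_betw (\<lambda>i. (i + k) mod n) {..<n} {..<n}"
proof -
  have "inj_on (\<lambda>i. (i + k) mod n) {..<n}"
  proof (rule inj_onI)
    fix i j assume ij: "i \<in> {..<n}" "j \<in> {..<n}" and eq: "(i + k) mod n = (j + k) mod n"
    have "(int i + int k) mod int n = (int j + int k) mod int n"
      using eq by (metis of_nat_add zmod_int)
    then have "int n dvd (int i + int k) - (int j + int k)"
      by (rule mod_eq_dvd_iff[THEN iffD1])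
    then have "int n dvd int i - int j" by simp
    moreover have "\<bar>int i - int j\<bar> < int n" using ij by auto
    ultimately have "int i - int j = 0"
      using dvd_imp_le_int[of "int i - int j" "int n"] by fastforce
    then show "i = j" by simp
  qed
  moreover have "(\<lambda>i. (i + k) mod n) ` {..<n} \<subseteq> {..<n}" using assms by auto
  ultimately show ?thesis
    by (simp add: bij_betw_def endo_inj_surj)
qed

context ri_space
begin

lemma sum_mem_norm:
  assumes "finite I" "\<And>i. i \<in> I \<Longrightarrow> u i \<in> X"
  shows "(\<lambda>x. \<Sum>i\<in>I. u i x) \<in> X \<and> N (\<lambda>x. \<Sum>i\<in>I. u i x) \<le> (\<Sum>i\<in>I. N (u i))"
  using assms
proof (induction I)
  case empty
  then show ?case using zero_mem norm_eq_zero[OF zero_mem] by auto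
next
  case (insert i I)
  then show ?case
    using add_mem[of "u i" "\<lambda>x. \<Sum>i\<in>I. u i x"] norm_triangle[of "u i" "\<lambda>x. \<Sum>i\<in>I. u i x"] by auto
qed

lemma indicator_mem:
  assumes "E \<in> sets M" "emeasure M E < \<infinity>"
  shows "indicator E \<in> X"
  using indicator_mem_L1_Linf[OF assms] intersection_embeds by auto

text \<open>Averaging a step function over the cyclic rearrangements of its values, all of the same norm,
  gives a constant multiple of an indicator.\<close>

lemma norm_mean_le:
  fixes c :: "nat \<Rightarrow> real"
  assumes E: "disjoint_family_on E {..<n}" "\<And>i. i < n \<Longrightarrow> E i \<in> sets M"
    "\<And>i. i < n \<Longrightarrow> emeasure M (E i) = \<tau>" and fin: "\<tau> < \<infinity>" and n: "0 < n" and c: "\<And>i. 0 \<le> c i"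
  shows "(\<Sum>i<n. c i) * N (indicator (\<Union>i<n. E i)) \<le> real n * N (\<lambda>x. \<Sum>i<n. c i * indicator (E i) x)"
proof -
  define u where "u = (\<lambda>k x. \<Sum>i<n. c ((i + k) mod n) * indicator (E i) x)"
  have mem: "indicator (E i) \<in> X" if "i < n" for i
    using that E fin by (intro indicator_mem) auto
  have u_mem: "u k \<in> X" for k
    unfolding u_def using mem by (intro conjunct1[OF sum_mem_norm] scale_mem) auto
  have u0: "u 0 = (\<lambda>x. \<Sum>i<n. c i * indicator (E i) x)"
    by (auto simp: u_def intro!: sum.cong)
  have "rearr M (u k) t = rearr M (u 0) t" for k t
    unfolding u0 unfolding u_def using E bij_betw_add_mod[OF n, of k]
    by (intro rearr_step_function_permute[where \<sigma> = "\<lambda>i. (i + k) mod n" and \<tau> = \<tau>]) auto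
  then have Nu: "N (u k) = N (u 0)" for k
  proof -
    have "u k \<in> borel_measurable M" using u_mem measurable by auto
    then show ?thesis
      using rearrangement_invariant[of "u 0" "u k"] u_mem \<open>\<And>k t. rearr M (u k) t = rearr M (u 0) t\<close> by metis
  qed
  have "(\<lambda>x. \<Sum>k<n. u k x) = (\<lambda>x. (\<Sum>i<n. c i) * indicator (\<Union>i<n. E i) x)"
  proof
    fix x
    \<comment> \<open>As the shift runs through \<open>{..<n}\<close>, each piece receives every
      coefficient exactly once.\<close>
    have cyc: "(\<Sum>k<n. c ((i + k) mod n)) = (\<Sum>k<n. c k)" for i
      using sum.reindex_bij_betw[OF bij_betw_add_mod[OF n, of i], of c] by (simp add: add.commute)
    have "(\<Sum>k<n. u k x) = (\<Sum>i<n. (\<Sum>k<n. c ((i + k) mod n)) * indicator (E i) x)"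
      unfolding u_def by (subst sum.swap) (simp add: sum_distrib_right)
    also have "\<dots> = (\<Sum>i<n. (\<Sum>k<n. c k) * indicator (E i) x)"
      by (simp only: cyc)
    also have "\<dots> = (\<Sum>i<n. c i) * (\<Sum>i<n. indicator (E i) x)"
      by (simp add: sum_distrib_left)
    also have "(\<Sum>i<n. indicator (E i) x) = (indicator (\<Union>i<n. E i) x :: real)"
      using E(1) by (intro indicator_UN_disjoint[symmetric]) auto
    finally show "(\<Sum>k<n. u k x) = (\<Sum>i<n. c i) * indicator (\<Union>i<n. E i) x" .
  qed
  moreover have "N (\<lambda>x. \<Sum>k<n. u k x) \<le> (\<Sum>k<n. N (u k))"
    using u_mem by (intro conjunct2[OF sum_mem_norm]) auto
  moreover have "indicator (\<Union>i<n. E i) \<in> X"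
  proof (rule indicator_mem)
    have "emeasure M (\<Union>i<n. E i) = (\<Sum>i<n. emeasure M (E i))"
      using E by (intro sum_emeasure[symmetric]) auto
    then show "emeasure M (\<Union>i<n. E i) < \<infinity>"
      using E fin by (simp add: ennreal_mult_less_top of_nat_less_top)
  qed (use E in auto)
  ultimately show ?thesis
    using Nu c norm_scale[of "indicator (\<Union>i<n. E i)" "\<Sum>i<n. c i"] by (simp add: u0 sum_nonneg)
qed

end

text \<open>Counterpart of \<open>emeasure_gt_rearr_le\<close> for the weak inequality. It rests on
  continuity from above, which is why some lower level \<open>l\<close> must have a superlevel set
  of finite measure.\<close>

lemma emeasure_ge_rearr:
  assumes [measurable]: "f \<in> borel_measurable M" and a: "rearr M f s = ennreal a" "0 \<le> l" "l < a"
    and fin: "emeasure M {x \<in> space M. l < \<bar>f x\<bar>} < \<infinity>"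
  shows "ennreal s \<le> emeasure M {x \<in> space M. a \<le> \<bar>f x\<bar>}"
proof -
  \<comment> \<open>The levels start at \<open>m 0 = l\<close> and increase to \<open>a\<close>, so
    all the sets \<open>B n\<close> lie in the superlevel set of finite measure.\<close>
  define m where "m = (\<lambda>n. a - (a - l) / real (Suc n))"
  define B where "B = (\<lambda>n. {x \<in> space M. m n < \<bar>f x\<bar>})"
  have [measurable]: "B n \<in> sets M" for n unfolding B_def by measurable
  have m: "l \<le> m n" "m n < a" for n
  proof -
    have "(a - l) / real (Suc n) \<le> (a - l) / 1"
      using a by (intro divide_left_mono) auto
    then show "l \<le> m n" by (simp add: m_def)
    show "m n < a" using a by (simp add: m_def)
  qed
  have m_mono: "m i \<le> m j" if "i \<le> j" for i j
    unfolding m_def using a that by (intro diff_mono divide_left_mono) auto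
  have dec: "decseq B"
    unfolding decseq_def B_def using m_mono by (blast intro: le_less_trans)
  have "emeasure M (B n) \<noteq> \<infinity>" for n
  proof -
    have "emeasure M (B n) \<le> emeasure M {x \<in> space M. l < \<bar>f x\<bar>}"
      using m(1)[of n] by (intro emeasure_mono) (auto simp: B_def)
    then show ?thesis using fin by (auto simp: top_unique)
  qed
  then have inf: "(INF n. emeasure M (B n)) = emeasure M (\<Inter>n. B n)"
    using dec by (intro INF_emeasure_decseq) auto
  have lim: "m \<longlonglongrightarrow> a"
    unfolding m_def by real_asymp
  have "(\<Inter>n. B n) \<subseteq> {x \<in> space M. a \<le> \<bar>f x\<bar>}"
  proof
    fix x assume x: "x \<in> (\<Inter>n. B n)"
    then have "m n \<le> \<bar>f x\<bar>" for n by (auto simp: B_def less_imp_le)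
    then have "a \<le> \<bar>f x\<bar>"
      by (intro LIMSEQ_le_const2[OF lim]) auto
    then show "x \<in> {x \<in> space M. a \<le> \<bar>f x\<bar>}" using x by (auto simp: B_def)
  qed
  then have "emeasure M (\<Inter>n. B n) \<le> emeasure M {x \<in> space M. a \<le> \<bar>f x\<bar>}"
    by (intro emeasure_mono) auto
  moreover have "ennreal s \<le> (INF n. emeasure M (B n))"
  proof (rule INF_greatest)
    fix n
    have "ennreal (m n) < rearr M f s" "0 \<le> m n"
      using m[of n] a by (auto simp: ennreal_less_iff)
    from less_rearrD[OF this] show "ennreal s \<le> emeasure M (B n)"
      by (simp add: B_def)
  qed
  ultimately show ?thesis using inf by simp
qed

text \<open>Discrete form of the bound for the oscillation. On \<open>n\<close> disjoint layers of
  measure \<open>t / n\<close> the function (|g| - l)_+ is at least its decreasing rearrangement at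
  the right endpoint of the corresponding cell; \<open>norm_mean_le\<close> then compares with the
  indicator of the union, a set of measure \<open>t\<close>.\<close>

lemma fundamental_times_sum_le:
  fixes M :: "'a::metric_space measure"
  assumes mm: "metric_measure_space M" and ri: "ri_space M Z N" and [measurable]: "g \<in> borel_measurable M"
    and t: "0 < t" and fin: "\<And>s. 0 < s \<Longrightarrow> rearr M g s < \<infinity>" and l: "rearr M g t = ennreal l" "0 \<le> l"
    and h: "(\<lambda>x. max 0 (\<bar>g x\<bar> - l)) \<in> Z" and n: "0 < n"
  shows "fundamental M N t * (\<Sum>i<n. enn2real (rearr M g (real (Suc i) * (t / real n)) - ennreal l))
    \<le> real n * N (\<lambda>x. max 0 (\<bar>g x\<bar> - l))"
proof -
  interpret mm: metric_measure_space M by fact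
  interpret Z: ri_space M Z N by fact
  define \<tau> where "\<tau> = t / real n"
  have \<tau>: "0 < \<tau>" "real n * \<tau> = t" using t n by (auto simp: \<tau>_def)
  define h where "h = (\<lambda>x. max 0 (\<bar>g x\<bar> - l))"
  have [measurable]: "h \<in> borel_measurable M" unfolding h_def by measurable
  define r where "r = (\<lambda>i. enn2real (rearr M g (real (Suc i) * \<tau>)))"
  have r: "rearr M g (real (Suc i) * \<tau>) = ennreal (r i)" "0 \<le> r i" for i
    using fin[of "real (Suc i) * \<tau>"] \<tau> by (auto simp: r_def)
  \<comment> \<open>For \<open>i < n\<close> the point \<open>(i + 1) * \<tau>\<close> is at most
    \<open>t\<close>, so \<open>r i\<close> is already at least \<open>l\<close>. Cutting at 0
    matters for the later indices, since the chain of sets is infinite.\<close>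
  define \<beta> where "\<beta> = (\<lambda>i. max 0 (r i - l))"
  have \<beta>_eq: "enn2real (rearr M g (real (Suc i) * \<tau>) - ennreal l) = \<beta> i" for i
    using r[of i] l by (cases "r i \<le> l") (auto simp: \<beta>_def ennreal_minus max_def ennreal_neg)
  define A where "A = (\<lambda>i. {x \<in> space M. \<beta> i \<le> h x})"
  have "r (Suc i) \<le> r i" for i
  proof -
    have "rearr M g (real (Suc (Suc i)) * \<tau>) \<le> rearr M g (real (Suc i) * \<tau>)"
      using \<tau> by (intro rearr_antimono mult_right_mono) auto
    then show ?thesis unfolding r using r by simp
  qed
  then have "\<beta> (Suc i) \<le> \<beta> i" for i unfolding \<beta>_def by (intro max.mono) auto
  then have A_mono: "A i \<subseteq> A (Suc i)" for i
    unfolding A_def by (auto intro: order_trans)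
  have A_sets: "A i \<in> sets M" for i unfolding A_def by measurable
  have A_large: "ennreal (real (Suc i) * \<tau>) \<le> emeasure M (A i)" for i
  \<comment> \<open>In the first case the height \<open>\<beta> i\<close> is 0 and
    \<open>A i\<close> is the whole space, whose measure is infinite.\<close>
  proof (cases "r i \<le> l")
    case True
    then have "A i = UNIV" by (auto simp: A_def \<beta>_def h_def mm.space_UNIV)
    then show ?thesis using mm.infinite_total_measure by simp
  next
    case False
    have "emeasure M {x \<in> space M. l < \<bar>g x\<bar>} < \<infinity>"
      using emeasure_gt_rearr_le[of g M t l] l by (auto intro: le_less_trans)
    then have "ennreal (real (Suc i) * \<tau>) \<le> emeasure M {x \<in> space M. r i \<le> \<bar>g x\<bar>}"
      using False by (intro emeasure_ge_rearr[OF _ r(1) l(2)]) auto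
    also have "{x \<in> space M. r i \<le> \<bar>g x\<bar>} \<subseteq> A i"
      using False by (auto simp: A_def \<beta>_def h_def)
    then have "emeasure M {x \<in> space M. r i \<le> \<bar>g x\<bar>} \<le> emeasure M (A i)"
      using A_sets by (intro emeasure_mono) auto
    finally show ?thesis .
  qed
  obtain F where F: "F 0 = {}" "\<And>i. F i \<in> sets M" "\<And>i. F i \<subseteq> F (Suc i)"
    "\<And>i. F (Suc i) \<subseteq> A i" "\<And>i. emeasure M (F i) = ennreal (real i * \<tau>)"
    using mm.exists_chain[OF A_sets A_mono A_large] \<tau> by (metis less_imp_le)
  have F_mono: "F i \<subseteq> F j" if "i \<le> j" for i j
    using lift_Suc_mono_le[of F, OF F(3) that] .
  define E where "E = (\<lambda>i. F (Suc i) - F i)"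
  have E_sets: "E i \<in> sets M" for i using F by (auto simp: E_def)
  have E_meas: "emeasure M (E i) = ennreal \<tau>" for i
  proof -
    have "emeasure M (E i) = emeasure M (F (Suc i)) - emeasure M (F i)"
      unfolding E_def using F by (intro emeasure_Diff) auto
    also have "\<dots> = ennreal \<tau>"
      unfolding F(5) using \<tau> by (subst ennreal_minus) (auto simp: algebra_simps)
    finally show ?thesis .
  qed
  have E_disj: "E i \<inter> E j = {}" if "i < j" for i j
    using F_mono[of "Suc i" j] that by (auto simp: E_def)
  have disj: "disjoint_family_on E {..<n}"
    using E_disj by (auto simp: disjoint_family_on_def) (metis Int_iff empty_iff linorder_neqE_nat)
  have "(\<Union>i<k. E i) = F k" for k
    using F(1) subsetD[OF F(3)] by (induction k) (auto simp: lessThan_Suc E_def)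
  then have UE: "(\<Union>i<n. E i) = F n" .
  have "(\<Sum>i<n. \<beta> i * indicator (E i) x) \<le> h x" for x
  proof (cases "\<exists>i<n. x \<in> E i")
    case True
    then obtain i where i: "i < n" "x \<in> E i" by auto
    then have "x \<in> A i" using subsetD[OF F(4)] by (auto simp: E_def)
    then show ?thesis
      using sum_indicator_disjoint[OF disj, of i x \<beta>] i by (simp add: A_def)
  next
    case False
    then have "(\<Sum>i<n. \<beta> i * indicator (E i) x) = 0"
      by (intro sum.neutral) auto
    then show ?thesis by (simp add: h_def)
  qed
  moreover have "0 \<le> (\<Sum>i<n. \<beta> i * indicator (E i) x)" "0 \<le> h x" for x
    by (auto intro!: sum_nonneg simp: \<beta>_def h_def)
  ultimately have N_le: "N (\<lambda>x. \<Sum>i<n. \<beta> i * indicator (E i) x) \<le> N h"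
  proof (intro conjunct2[OF Z.lattice])
    show "(\<lambda>x. \<Sum>i<n. \<beta> i * indicator (E i) x) \<in> borel_measurable M"
      using E_sets by (intro borel_measurable_sum borel_measurable_times) auto
    show "h \<in> Z" using h by (simp add: h_def)
  qed auto
  have "(\<Sum>i<n. \<beta> i) * N (indicator (F n)) \<le> real n * N (\<lambda>x. \<Sum>i<n. \<beta> i * indicator (E i) x)"
    using Z.norm_mean_le[of E n "ennreal \<tau>" \<beta>] disj E_sets E_meas n UE by (auto simp: \<beta>_def)
  also have "\<dots> \<le> real n * N h"
    using N_le by (intro mult_left_mono) auto
  also have "N (indicator (F n)) = fundamental M N t"
    using F(2,5)[of n] \<tau> by (intro Z.fundamental_eq[symmetric]) auto
  finally show ?thesis
    unfolding \<tau>_def[symmetric] \<beta>_eq h_def[symmetric] by (simp add: mult.commute)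
qed

text \<open>The value at \<open>(i + 1) * \<tau>\<close> is the right endpoint value for the i-th
  cell, but the left one for the next cell. As the integrand decreases, the sums of
  \<open>fundamental_times_sum_le\<close> dominate its integral over \<open>{\<tau>..<t}\<close>.
  Only the first cell is missing, and monotone convergence recovers it as \<open>\<tau>\<close>
  tends to 0.\<close>

lemma fundamental_times_osc_le:
  fixes M :: "'a::metric_space measure"
  assumes mm: "metric_measure_space M" and ri: "ri_space M Z N" and g[measurable]: "g \<in> borel_measurable M"
    and t: "0 < t" and fin: "\<And>s. 0 < s \<Longrightarrow> rearr M g s < \<infinity>" and l: "rearr M g t = ennreal l" "0 \<le> l"
    and h: "(\<lambda>x. max 0 (\<bar>g x\<bar> - l)) \<in> Z" and \<phi>: "0 \<le> fundamental M N t"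
  shows "ennreal (fundamental M N t) * osc M g t \<le> ennreal (N (\<lambda>x. max 0 (\<bar>g x\<bar> - l)))"
proof -
  define \<phi> where "\<phi> = fundamental M N t"
  define c where "c = N (\<lambda>x. max 0 (\<bar>g x\<bar> - l))"
  have c: "0 \<le> c" using ri_space.norm_nonneg[OF ri h] by (simp add: c_def)
  define \<rho> where "\<rho> = (\<lambda>s. rearr M g s - ennreal l)"
  have [measurable]: "\<rho> \<in> borel_measurable borel" unfolding \<rho>_def by measurable
  have tail: "ennreal \<phi> * (\<integral>\<^sup>+s. \<rho> s * indicator {t / real (Suc k)..<t} s \<partial>lborel) \<le> ennreal (t * c)" for k
  proof -
    define n where "n = Suc k"
    define \<tau> where "\<tau> = t / real n"
    have \<tau>: "0 < \<tau>" "real n * \<tau> = t" using t by (auto simp: \<tau>_def n_def)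
    define \<beta> where "\<beta> = (\<lambda>i. enn2real (\<rho> (real (Suc i) * \<tau>)))"
    have \<rho>_fin: "\<rho> s < \<infinity>" if "0 < s" for s
      using fin[OF that] unfolding \<rho>_def by (auto intro: le_less_trans[OF diff_le_self_ennreal])
    have \<beta>: "\<rho> (real (Suc i) * \<tau>) = ennreal (\<beta> i)" "0 \<le> \<beta> i" for i
      using \<rho>_fin[of "real (Suc i) * \<tau>"] \<tau> by (auto simp: \<beta>_def)
    have "\<rho> s * indicator {\<tau>..<t} s
        \<le> (\<Sum>i<n. ennreal (\<beta> i) * indicator {real (Suc i) * \<tau>..<real (Suc (Suc i)) * \<tau>} s)" for s
    proof (cases "s \<in> {\<tau>..<t}")
      case True
      \<comment> \<open>The cell that contains \<open>s\<close> begins at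
        \<open>(i + 1) * \<tau>\<close>; subtracting 1 is legitimate because \<open>s\<close> is at
        least \<open>\<tau>\<close>.\<close>
      define i where "i = nat \<lfloor>s / \<tau>\<rfloor> - 1"
      have "1 \<le> s / \<tau>" "s / \<tau> < real n" using True \<tau> by (auto simp: field_simps)
      then have i: "real (Suc i) \<le> s / \<tau>" "s / \<tau> < real (Suc (Suc i))" "i < n"
        unfolding i_def by linarith+
      then have s: "real (Suc i) * \<tau> \<le> s" "s < real (Suc (Suc i)) * \<tau>"
        using \<tau> by (auto simp: field_simps)
      have "\<rho> s \<le> \<rho> (real (Suc i) * \<tau>)"
        unfolding \<rho>_def using s by (intro ennreal_minus_mono rearr_antimono) auto
      also have "\<dots> = ennreal (\<beta> i) * indicator {real (Suc i) * \<tau>..<real (Suc (Suc i)) * \<tau>} s"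
        unfolding \<beta>(1) using s by simp
      also have "\<dots> \<le> (\<Sum>i<n. ennreal (\<beta> i) * indicator {real (Suc i) * \<tau>..<real (Suc (Suc i)) * \<tau>} s)"
        using i by (intro member_le_sum) auto
      finally show ?thesis using True by simp
    qed simp
    then have "(\<integral>\<^sup>+s. \<rho> s * indicator {\<tau>..<t} s \<partial>lborel)
      \<le> (\<integral>\<^sup>+s. (\<Sum>i<n. ennreal (\<beta> i) * indicator {real (Suc i) * \<tau>..<real (Suc (Suc i)) * \<tau>} s) \<partial>lborel)"
      by (intro nn_integral_mono)
    also have "\<dots> = (\<Sum>i<n. ennreal (\<beta> i) * ennreal \<tau>)"
      using \<tau> by (subst nn_integral_sum) (auto simp: nn_integral_cmult algebra_simps)
    also have "\<dots> = ennreal ((\<Sum>i<n. \<beta> i) * \<tau>)"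
      using \<beta> \<tau> by (subst ennreal_mult) (auto simp: sum_nonneg sum_distrib_right[symmetric] simp flip: sum_ennreal)
    finally have "ennreal \<phi> * (\<integral>\<^sup>+s. \<rho> s * indicator {\<tau>..<t} s \<partial>lborel) \<le> ennreal \<phi> * ennreal ((\<Sum>i<n. \<beta> i) * \<tau>)"
      by (rule mult_left_mono) simp
    also have "\<dots> = ennreal (\<phi> * (\<Sum>i<n. \<beta> i) * \<tau>)"
      using \<phi> \<beta> \<tau> by (subst ennreal_mult[symmetric]) (auto simp: \<phi>_def sum_nonneg mult.assoc)
    also have "\<dots> \<le> ennreal (t * c)"
    proof (rule ennreal_leI)
      have "\<phi> * (\<Sum>i<n. \<beta> i) \<le> real n * c"
        unfolding \<phi>_def c_def \<beta>_def \<rho>_def \<tau>_def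
        by (rule fundamental_times_sum_le[OF mm ri g t fin l h]) (auto simp: n_def)
      then have "\<phi> * (\<Sum>i<n. \<beta> i) * \<tau> \<le> real n * c * \<tau>"
        using \<tau> by (intro mult_right_mono) auto
      then show "\<phi> * (\<Sum>i<n. \<beta> i) * \<tau> \<le> t * c"
        unfolding \<tau>(2)[symmetric] by (simp only: mult_ac)
    qed
    finally show ?thesis by (simp add: \<tau>_def n_def)
  qed
  define J where "J = (\<integral>\<^sup>+s. \<rho> s * indicator {0<..<t} s \<partial>lborel)"
  have cover: "\<rho> s * indicator {0<..<t} s = (SUP k. \<rho> s * indicator {t / real (Suc k)..<t} s)" for s
  proof (cases "0 < s \<and> s < t")
    case True
    then obtain k where "1 / real (Suc k) < s / t"
      using nat_approx_posE[of "s / t"] t by auto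
    then have "s \<in> {t / real (Suc k)..<t}"
      using True t by (auto simp: field_simps)
    then have "\<rho> s \<le> (SUP k. \<rho> s * indicator {t / real (Suc k)..<t} s)"
      by (intro SUP_upper2[of k]) auto
    moreover have "(SUP k. \<rho> s * indicator {t / real (Suc k)..<t} s) \<le> \<rho> s"
      by (intro SUP_least) (auto simp: indicator_def)
    ultimately show ?thesis using True by (simp add: antisym)
  next
    case False
    have "0 < t / real (Suc k)" for k using t by simp
    then have "s \<notin> {t / real (Suc k)..<t}" for k
      using False by (auto simp: not_less) (meson order_less_le_trans not_le)
    then show ?thesis using False by simp
  qed
  have "incseq (\<lambda>k s. \<rho> s * indicator {t / real (Suc k)..<t} s)"
  proof (rule incseq_SucI, rule le_funI)
    fix k s
    have "t / real (Suc (Suc k)) \<le> t / real (Suc k)"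
      using t by (intro divide_left_mono) auto
    then show "\<rho> s * indicator {t / real (Suc k)..<t} s \<le> \<rho> s * indicator {t / real (Suc (Suc k))..<t} s"
      by (intro mult_left_mono) (auto simp: indicator_def)
  qed
  then have "J = (SUP k. \<integral>\<^sup>+s. \<rho> s * indicator {t / real (Suc k)..<t} s \<partial>lborel)"
    unfolding J_def cover by (intro nn_integral_monotone_convergence_SUP) auto
  then have J: "ennreal \<phi> * J \<le> ennreal (t * c)"
    using tail by (simp add: SUP_mult_left_ennreal) (intro SUP_least)
  have "(\<integral>\<^sup>+s\<in>{0<..<t}. rearr M g s \<partial>lborel) \<le> (\<integral>\<^sup>+s. ennreal l * indicator {0<..<t} s + \<rho> s * indicator {0<..<t} s \<partial>lborel)"
    using ennreal_minus_le_iff[THEN iffD1, OF order_refl, of "rearr M g _" "ennreal l"]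
    by (intro nn_integral_mono) (auto simp: \<rho>_def indicator_def)
  also have "\<dots> = ennreal l * ennreal t + J"
    using t by (subst nn_integral_add) (auto simp: nn_integral_cmult J_def)
  finally have "rearr_avg M g t \<le> (ennreal l * ennreal t + J) / ennreal t"
    unfolding rearr_avg_def by (rule divide_right_mono_ennreal)
  also have "\<dots> = ennreal l + J / ennreal t"
    using t by (simp add: add_divide_distrib_ennreal ennreal_mult_divide_eq)
  finally have "osc M g t \<le> J / ennreal t"
    unfolding osc_def l(1) by (intro ennreal_minus_le_iff[THEN iffD2]) auto
  then have "ennreal \<phi> * osc M g t \<le> ennreal \<phi> * (J / ennreal t)"
    by (rule mult_left_mono) simp
  also have "\<dots> \<le> ennreal (t * c) / ennreal t"
    using divide_right_mono_ennreal[OF J, of "ennreal t"] by (simp add: ennreal_times_divide)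
  also have "\<dots> = ennreal c"
    using t c by (simp add: divide_ennreal)
  finally show ?thesis by (simp add: \<phi>_def c_def)
qed

section \<open>The oscillation inequality\<close>

lemma epow_1 [simp]: "epow a 1 = a"
  by (cases a) (auto simp: epow_ennreal)

text \<open>The fractions x/(x+y) and y/(x+y) lie in the unit interval, where taking the p-th power
  does not decrease them, and they add up to 1.\<close>

lemma powr_add_le:
  fixes x y p :: real
  assumes "0 \<le> x" "0 \<le> y" "0 < p" "p \<le> 1"
  shows "(x + y) powr p \<le> x powr p + y powr p"
proof (cases "x + y = 0")
  case False
  then have s: "0 < x + y" using assms by auto
  have le: "z / (x + y) \<le> z powr p / (x + y) powr p" if "0 \<le> z" "z \<le> x + y" for z
  proof -
    have "(z / (x + y)) powr 1 \<le> (z / (x + y)) powr p"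
      using that assms s by (intro powr_mono') auto
    then show ?thesis using that s by (simp add: powr_divide)
  qed
  have "1 = x / (x + y) + y / (x + y)"
    using s by (simp add: add_divide_distrib[symmetric])
  also have "\<dots> \<le> x powr p / (x + y) powr p + y powr p / (x + y) powr p"
    using le[of x] le[of y] assms by (intro add_mono) auto
  finally show ?thesis
    using s by (simp add: add_divide_distrib[symmetric] le_divide_eq)
qed (use assms in auto)

text \<open>Powers leave indicators unchanged, so only the outer exponent acts. With
  \<open>k = 1 / p\<close> the fundamental function is raised to the power p.\<close>

lemma fundamental_convexify:
  "fundamental M (convexify_norm k N) t = fundamental M N t powr (1 / k)"
proof -
  have "(\<lambda>x. \<bar>indicator E x :: real\<bar> powr k) = indicator E" for E :: "'a set"
    by (auto simp: indicator_def)
  then show ?thesis by (simp add: fundamental_def convexify_norm_def)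
qed

context metric_measure_space
begin

lemma exists_superset:
  assumes "F \<in> sets M" "emeasure M F \<le> ennreal t" "0 \<le> t"
  obtains E where "E \<in> sets M" "F \<subseteq> E" "emeasure M E = ennreal t"
  using exists_intermediate_set[of F UNIV t] assms infinite_total_measure sets.top[of M]
  by (auto simp: space_UNIV)

lemma fundamental_ge:
  assumes "ri_space M X N" "F \<in> sets M" "emeasure M F \<le> ennreal t" "0 \<le> t"
  shows "N (indicator F) \<le> fundamental M N t" "0 \<le> fundamental M N t"
proof -
  interpret X: ri_space M X N by fact
  obtain E where E: "E \<in> sets M" "F \<subseteq> E" "emeasure M E = ennreal t"
    using exists_superset assms by metis
  then have mem: "indicator E \<in> X" by (intro X.indicator_mem) auto
  have eq: "fundamental M N t = N (indicator E)"
    using E by (intro X.fundamental_eq)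
  show "0 \<le> fundamental M N t"
    unfolding eq using X.norm_nonneg[OF mem] .
  show "N (indicator F) \<le> fundamental M N t"
    unfolding eq using E assms mem by (intro conjunct2[OF X.lattice]) (auto simp: indicator_def)
qed

lemma integrable_powr_diff:
  assumes f: "f \<in> Lp_loc M p" and p: "0 < p" and r: "0 < r"
  shows "set_integrable M (ball x r) (\<lambda>y. \<bar>a - f y\<bar> powr p)"
proof -
  have [measurable]: "f \<in> borel_measurable M" using f by (simp add: Lp_loc_def)
  have "set_integrable M (ball x r) (\<lambda>y. \<bar>f y\<bar> powr p)"
    using f r by (auto simp: Lp_loc_def)
  then have "integrable M (\<lambda>y. 2 powr p * (indicator (ball x r) y * \<bar>a\<bar> powr p + indicator (ball x r) y *\<^sub>R \<bar>f y\<bar> powr p))"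
    using ball_finite[OF r, of x] unfolding set_integrable_def
    by (intro integrable_mult_right integrable_add integrable_mult_left) (auto simp: less_top)
  then show ?thesis
    unfolding set_integrable_def
  proof (rule Bochner_Integration.integrable_bound)
    \<comment> \<open>Comparison with twice the maximum avoids convexity and so covers p < 1 and p
      \<ge> 1 at once.\<close>
    have "\<bar>a - f y\<bar> powr p \<le> 2 powr p * (\<bar>a\<bar> powr p + \<bar>f y\<bar> powr p)" for y
    proof -
      have "\<bar>a - f y\<bar> powr p \<le> (2 * max \<bar>a\<bar> \<bar>f y\<bar>) powr p"
        using p by (intro powr_mono2) auto
      also have "\<dots> = 2 powr p * max \<bar>a\<bar> \<bar>f y\<bar> powr p"
        by (simp add: powr_mult)
      also have "\<dots> \<le> 2 powr p * (\<bar>a\<bar> powr p + \<bar>f y\<bar> powr p)"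
        by (intro mult_left_mono) (auto simp: max_def)
      finally show ?thesis .
    qed
    then show "AE y in M. norm (indicator (ball x r) y *\<^sub>R \<bar>a - f y\<bar> powr p)
      \<le> norm (2 powr p * (indicator (ball x r) y * \<bar>a\<bar> powr p + indicator (ball x r) y *\<^sub>R \<bar>f y\<bar> powr p))"
      by (auto simp: indicator_def)
  qed simp
qed

text \<open>The balls have at least twice the measure of the superlevel set, so at least half of each ball
  sees the full height above the level.\<close>

lemma truncation_le_avg_diff:
  assumes f: "f \<in> Lp_loc M p" and p: "0 < p" "p0 = min 1 p" and r: "0 < r" and "0 \<le> t" "0 \<le> l"
    and level: "emeasure M {x \<in> space M. l < \<bar>f x\<bar> powr p0} \<le> ennreal t"
    and large: "ennreal (2 * t) \<le> emeasure M (ball x r)"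
  shows "max 0 (\<bar>f x\<bar> powr p0 - l) powr (1 / p0) \<le> 2 powr (1 / p) * avg_diff M p r f x"
proof (cases "l < \<bar>f x\<bar> powr p0")
  case False
  then show ?thesis by (simp add: avg_diff_def max_def)
next
  case True
  have [measurable]: "f \<in> borel_measurable M" using f by (simp add: Lp_loc_def)
  define d where "d = \<bar>f x\<bar> powr p0 - l"
  define B where "B = ball x r"
  define V where "V = {y \<in> space M. l < \<bar>f y\<bar> powr p0}"
  have [measurable]: "B \<in> sets M" "V \<in> sets M" unfolding B_def V_def by measurable
  have p0: "0 < p0" using p by auto
  have d: "0 < d" using True by (simp add: d_def)
  have B: "emeasure M B = ennreal (measure M B)" "0 < measure M B"
    using emeasure_ball[OF r] by (auto simp: B_def)
  have V: "emeasure M V = ennreal (measure M V)"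
    using level by (intro emeasure_eq_ennreal_measure) (auto simp: V_def top_unique)
  have "measure M V \<le> t" "2 * t \<le> measure M B"
    using level large B V \<open>0 \<le> t\<close> by (auto simp: V_def[symmetric] B_def[symmetric] ennreal_le_iff2)
  moreover have "measure M (B \<inter> V) \<le> measure M V"
    using V by (intro measure_mono_fmeasurable fmeasurableI) auto
  moreover have "measure M (B - V) = measure M B - measure M (B \<inter> V)"
    using B measure_Diff[of M B "B \<inter> V"] by (simp add: Diff_Int)
  ultimately have half: "measure M B / 2 \<le> measure M (B - V)"
    by simp
  \<comment> \<open>The exponent \<open>p / p0\<close> is p for p \<ge> 1 and 1 for p < 1. In both
    cases this is the bound |f x|^p0 - |f y|^p0 \<le> |f x - f y|^p0 raised to the power that
    produces |f x - f y|^p.\<close>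
  have point: "d powr (p / p0) \<le> \<bar>f x - f y\<bar> powr p" if "y \<in> B - V" for y
  proof -
    have y: "\<bar>f y\<bar> powr p0 \<le> l" using that by (auto simp: V_def space_UNIV)
    show ?thesis
    proof (cases "1 \<le> p")
      case True
      then have "p0 = 1" using p by simp
      then have "d \<le> \<bar>f x - f y\<bar>" using y by (simp add: d_def)
      then show ?thesis using \<open>p0 = 1\<close> p d by (auto intro!: powr_mono2)
    next
      case False
      then have "p0 = p" using p by simp
      have "\<bar>f x\<bar> powr p \<le> (\<bar>f x - f y\<bar> + \<bar>f y\<bar>) powr p"
        using p by (intro powr_mono2) auto
      also have "\<dots> \<le> \<bar>f x - f y\<bar> powr p + \<bar>f y\<bar> powr p"
        using p False by (intro powr_add_le) auto
      finally show ?thesis using y \<open>p0 = p\<close> p d by (simp add: d_def)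
    qed
  qed
  have "d powr (p / p0) * (measure M B / 2) \<le> d powr (p / p0) * measure M (B - V)"
    using half by (intro mult_left_mono) auto
  also have "\<dots> = (LINT y|M. indicator (B - V) y * d powr (p / p0))"
    by (simp add: mult.commute)
  also have "\<dots> \<le> (LINT y:B|M. \<bar>f x - f y\<bar> powr p)"
    unfolding set_lebesgue_integral_def
  proof (rule integral_mono)
    have "emeasure M (B - V) < \<infinity>"
      using emeasure_mono[of "B - V" B M] B by (auto intro: le_less_trans)
    then show "integrable M (\<lambda>y. indicator (B - V) y * d powr (p / p0))" by simp
    show "integrable M (\<lambda>y. indicator B y *\<^sub>R \<bar>f x - f y\<bar> powr p)"
      using integrable_powr_diff[OF f p(1) r] by (simp add: B_def set_integrable_def)
    show "indicator (B - V) y * d powr (p / p0) \<le> indicator B y *\<^sub>R \<bar>f x - f y\<bar> powr p" for y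
      using point[of y] by (auto simp: indicator_def)
  qed
  finally have "d powr (p / p0) / 2 \<le> (LINT y:B|M. \<bar>f x - f y\<bar> powr p) / measure M B"
    using B by (simp add: field_simps)
  then have "(d powr (p / p0) / 2) powr (1 / p) \<le> avg_diff M p r f x"
    unfolding avg_diff_def B_def[symmetric] using p by (intro powr_mono2) auto
  then have "d powr (1 / p0) / 2 powr (1 / p) \<le> avg_diff M p r f x"
    using p p0 by (simp add: powr_divide powr_powr)
  then show ?thesis
    using d by (simp add: d_def field_simps max_def)
qed

text \<open>The estimate at a single pair of \<open>t\<close> and \<open>r\<close>, before
  integration. The lattice property turns the pointwise bound of
  \<open>truncation_le_avg_diff\<close> into membership and a norm bound for
  \<open>h powr (1 / p0)\<close>.\<close>

lemma fundamental_osc_le_modulus: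
  assumes X: "ri_space M X N" and Y: "ri_space M (convexify M (1 / p) X) (convexify_norm (1 / p) N)"
    and f: "f \<in> Lp_loc M p" and p: "0 < p" "p0 = min 1 p" and r: "0 < r" and t: "0 < t"
    and sum: "(\<lambda>x. \<bar>f x\<bar> powr p0) \<in> L1_plus_Linf M"
    and large: "\<And>x. ennreal (2 * t) \<le> emeasure M (ball x r)"
  shows "ennreal (fundamental M N t) * epow (osc M (\<lambda>x. \<bar>f x\<bar> powr p0) t) (1 / p0)
    \<le> ennreal (2 powr (1 / p)) * smoothness_modulus M X N p f r"
proof (cases "avg_diff M p r f \<in> X")
  case False
  then show ?thesis by (simp add: smoothness_modulus_def ext_norm_def ennreal_mult_top)
next
  case True
  interpret X: ri_space M X N by fact
  have [measurable]: "f \<in> borel_measurable M" using f by (simp add: Lp_loc_def)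
  define g where "g = (\<lambda>x. \<bar>f x\<bar> powr p0)"
  have [measurable]: "g \<in> borel_measurable M" unfolding g_def by measurable
  have fin: "rearr M g s < \<infinity>" if "0 < s" for s
    using rearr_finite[OF sum that] by (simp add: g_def)
  obtain l where l: "rearr M g t = ennreal l" "0 \<le> l"
    using fin[OF t] by (cases "rearr M g t") auto
  define h where "h = (\<lambda>x. max 0 (\<bar>g x\<bar> - l))"
  have [measurable]: "h \<in> borel_measurable M" unfolding h_def by measurable
  have \<phi>: "0 \<le> fundamental M N t"
    using fundamental_ge(2)[OF X, of "{}" t] t by simp
  have "h x powr (1 / p0) \<le> 2 powr (1 / p) * avg_diff M p r f x" for x
    unfolding h_def g_def abs_of_nonneg[OF powr_ge_zero]
    using truncation_le_avg_diff[OF f p r less_imp_le[OF t] l(2) _ large] emeasure_gt_rearr_le[OF _ l]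
    by (simp add: g_def)
  then have *: "(\<lambda>x. h x powr (1 / p0)) \<in> X \<and> N (\<lambda>x. h x powr (1 / p0)) \<le> N (\<lambda>x. 2 powr (1 / p) * avg_diff M p r f x)"
    by (intro X.lattice X.scale_mem[OF True]) (auto intro: order_trans[OF _ abs_ge_self])
  have "ennreal (fundamental M N t) * epow (osc M g t) (1 / p0) \<le> ennreal (N (\<lambda>x. h x powr (1 / p0)))"
  proof (cases "1 \<le> p")
    case True
    then have "p0 = 1" using p by simp
    moreover have "(\<lambda>x. h x powr 1) = h" by (auto simp: h_def)
    ultimately show ?thesis
      using fundamental_times_osc_le[OF metric_measure_space_axioms X _ t fin l _ \<phi>] * by (simp add: h_def)
  next
    \<comment> \<open>Here \<open>h\<close> belongs to the convexified space exactly because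
      \<open>h powr (1 / p)\<close> is in \<open>X\<close>. The estimate there has
      \<open>fundamental M N t powr p\<close> as its factor; the final power 1/p removes this
      exponent.\<close>
    case False
    then have p0: "p0 = p" using p by simp
    have habs: "\<bar>h x\<bar> = h x" for x by (auto simp: h_def)
    have mem: "h \<in> convexify M (1 / p) X" using * p0 habs by (simp add: convexify_def)
    have Nh: "convexify_norm (1 / p) N h = N (\<lambda>x. h x powr (1 / p)) powr p"
      by (simp add: convexify_norm_def habs)
    have "ennreal (fundamental M N t powr p) * osc M g t \<le> ennreal (N (\<lambda>x. h x powr (1 / p)) powr p)"
      using fundamental_times_osc_le[OF metric_measure_space_axioms Y _ t fin l] mem
      by (simp add: fundamental_convexify Nh flip: h_def)
    then have "epow (ennreal (fundamental M N t powr p) * osc M g t) (1 / p) \<le> epow (ennreal (N (\<lambda>x. h x powr (1 / p)) powr p)) (1 / p)"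
      using p by (intro epow_mono) auto
    then show ?thesis
      using p p0 \<phi> X.norm_nonneg[of "\<lambda>x. h x powr (1 / p)"] * by (simp add: epow_mult epow_ennreal powr_powr)
  qed
  also have "\<dots> \<le> ennreal (2 powr (1 / p) * N (avg_diff M p r f))"
    using * X.norm_scale[OF True, of "2 powr (1 / p)"] by (intro ennreal_leI) simp
  also have "\<dots> = ennreal (2 powr (1 / p)) * smoothness_modulus M X N p f r"
    using True X.norm_nonneg[OF True] by (simp add: smoothness_modulus_def ext_norm_def ennreal_mult)
  finally show ?thesis by (simp add: g_def)
qed

lemma oscillation_inequality_if_lower_bound:
  assumes X: "ri_space M X N" and Y: "ri_space M (convexify M (1 / p) X) (convexify_norm (1 / p) N)"
    and Q: "0 < Q" and p: "0 < p" "p0 = min 1 p" and q: "0 < q" and c: "0 < c"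
    and growth: "\<And>r. 0 < r \<Longrightarrow> ennreal (c * r powr Q) \<le> ball_growth M r"
  shows "\<exists>C::real. 0 < C \<and> (\<forall>f \<in> borel_measurable M. (\<lambda>x. \<bar>f x\<bar> powr p0) \<in> L1_plus_Linf M \<longrightarrow>
     Lq_dt_over_t q (\<lambda>t. ennreal (fundamental M N t * t powr (- (\<theta> / Q))) *
        epow (osc M (\<lambda>x. \<bar>f x\<bar> powr p0) t) (1 / p0)) \<le> ennreal C * besov_seminorm M X N \<theta> p q f)"
proof -
  obtain K :: real where K: "0 < K"
    "\<And>a F. 0 < a \<Longrightarrow> Lq_dt_over_t q F \<le> ennreal K * Lq_dt_over_t q (\<lambda>r. F (a * r powr Q))"
    by (rule Lq_substitution[OF Q q]) (rule that)
  \<comment> \<open>With \<open>t = a * r powr Q\<close>, the measure \<open>2 * t\<close> required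
    of the balls is exactly the assumed lower bound \<open>c * r powr Q\<close>.\<close>
  define a where "a = c / 2"
  have a: "0 < a" using c by (simp add: a_def)
  define b where "b = a powr (- (\<theta> / Q)) * 2 powr (1 / p)"
  have b: "0 < b" using a by (simp add: b_def)
  have "Lq_dt_over_t q (\<lambda>t. ennreal (fundamental M N t * t powr (- (\<theta> / Q))) *
      epow (osc M (\<lambda>x. \<bar>f x\<bar> powr p0) t) (1 / p0)) \<le> ennreal (K * b) * besov_seminorm M X N \<theta> p q f" (is "Lq_dt_over_t q ?F \<le> _")
    if sum: "(\<lambda>x. \<bar>f x\<bar> powr p0) \<in> L1_plus_Linf M" for f
  proof (cases "f \<in> Lp_loc M p")
    case False
    then show ?thesis using K b by (simp add: besov_seminorm_def ennreal_mult_top)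
  next
    case True
    have "?F (a * r powr Q) \<le> ennreal b * (ennreal (r powr (- \<theta>)) * smoothness_modulus M X N p f r)" if r: "0 < r" for r
    proof -
      define t where "t = a * r powr Q"
      have t: "0 < t" using a r by (simp add: t_def)
      have "ennreal (2 * t) \<le> emeasure M (ball x r)" for x
        using growth[OF r] by (auto simp: t_def a_def ball_growth_def le_INF_iff)
      then have *: "ennreal (fundamental M N t) * epow (osc M (\<lambda>x. \<bar>f x\<bar> powr p0) t) (1 / p0)
        \<le> ennreal (2 powr (1 / p)) * smoothness_modulus M X N p f r"
        by (intro fundamental_osc_le_modulus[OF X Y True p r t sum])
      have \<phi>: "0 \<le> fundamental M N t"
        using fundamental_ge(2)[OF X, of "{}" t] t by simp
      have tr: "t powr (- (\<theta> / Q)) = a powr (- (\<theta> / Q)) * r powr (- \<theta>)"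
        using a r Q by (simp add: t_def powr_mult powr_powr)
      have "?F t = ennreal (t powr (- (\<theta> / Q))) * (ennreal (fundamental M N t) * epow (osc M (\<lambda>x. \<bar>f x\<bar> powr p0) t) (1 / p0))"
        using \<phi> by (simp add: ennreal_mult mult_ac)
      also have "\<dots> \<le> ennreal (t powr (- (\<theta> / Q))) * (ennreal (2 powr (1 / p)) * smoothness_modulus M X N p f r)"
        by (intro mult_left_mono *) simp
      also have "\<dots> = ennreal b * (ennreal (r powr (- \<theta>)) * smoothness_modulus M X N p f r)"
        unfolding tr b_def by (simp add: ennreal_mult mult_ac)
      finally show ?thesis by (simp add: t_def)
    qed
    then have "Lq_dt_over_t q (\<lambda>r. ?F (a * r powr Q))
        \<le> Lq_dt_over_t q (\<lambda>r. ennreal b * (ennreal (r powr (- \<theta>)) * smoothness_modulus M X N p f r))"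
      by (rule Lq_mono)
    also have "\<dots> \<le> ennreal b * besov_seminorm M X N \<theta> p q f"
      using Lq_cmult_le[OF b q] True by (simp add: besov_seminorm_def)
    finally have "ennreal K * Lq_dt_over_t q (\<lambda>r. ?F (a * r powr Q)) \<le> ennreal K * (ennreal b * besov_seminorm M X N \<theta> p q f)"
      by (rule mult_left_mono) simp
    also have "\<dots> = ennreal (K * b) * besov_seminorm M X N \<theta> p q f"
      using K b by (simp add: ennreal_mult mult_ac)
    finally show ?thesis
      using K(2)[OF a, of ?F] by (rule order_trans[rotated])
  qed
  then show ?thesis using K b by (intro exI[of _ "K * b"]) auto
qed

end

section \<open>Test functions\<close>

text \<open>The mass of [m, 2m] under dt/t does not depend on \<open>m\<close>. The crude bound 1/t
  \<ge> 1/(2m) makes it at least 1/2, whence the constant (1/2)^(1/q) for finite q.\<close>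

lemma Lq_ge_of_ge_on_octave:
  assumes "0 < q"
  obtains L :: real where "0 < L"
    "\<And>F m k. 0 < m \<Longrightarrow> 0 \<le> k \<Longrightarrow> (\<And>t. m \<le> t \<Longrightarrow> t \<le> 2 * m \<Longrightarrow> ennreal k \<le> F t) \<Longrightarrow> ennreal (L * k) \<le> Lq_dt_over_t q F"
proof (cases "q = \<infinity>")
  case True
  have "ennreal (1 * k) \<le> Lq_dt_over_t q F"
    if "0 < m" "\<And>t. m \<le> t \<Longrightarrow> t \<le> 2 * m \<Longrightarrow> ennreal k \<le> F t" for F and m k :: real
    using that True by (auto simp: Lq_dt_over_t_def intro!: SUP_upper2[of m])
  then show ?thesis by (intro that[of 1]) auto
next
  case False
  define s where "s = enn2real q"
  have s: "0 < s"
    using assms False by (simp add: s_def enn2real_positive_iff less_top)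
  have "ennreal ((1 / 2) powr (1 / s) * k) \<le> Lq_dt_over_t q F"
    if m: "0 < m" and k: "0 \<le> k" and F: "\<And>t. m \<le> t \<Longrightarrow> t \<le> 2 * m \<Longrightarrow> ennreal k \<le> F t" for F and m k :: real
  proof -
    have "ennreal (k powr s / 2) = (\<integral>\<^sup>+t. ennreal (k powr s / (2 * m)) * indicator {m..2 * m} t \<partial>lborel)"
      using m by (subst nn_integral_cmult) (auto simp flip: ennreal_mult)
    also have "\<dots> \<le> (\<integral>\<^sup>+t\<in>{0<..}. epow (F t) s / ennreal t \<partial>lborel)"
    proof (rule nn_integral_mono)
      fix t
      have "ennreal (k powr s / (2 * m)) \<le> epow (F t) s / ennreal t" if t: "t \<in> {m..2 * m}"
      proof -
        have "ennreal (k powr s / (2 * m)) \<le> ennreal (k powr s / t)"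
          using t m by (intro ennreal_leI divide_left_mono) auto
        also have "\<dots> = epow (ennreal k) s / ennreal t"
          using t m k by (simp add: epow_ennreal divide_ennreal)
        also have "\<dots> \<le> epow (F t) s / ennreal t"
          using t F s by (intro divide_right_mono_ennreal epow_mono) auto
        finally show ?thesis .
      qed
      then show "ennreal (k powr s / (2 * m)) * indicator {m..2 * m} t \<le> epow (F t) s / ennreal t * indicator {0<..} t"
        using m by (auto simp: indicator_def)
    qed
    finally have "epow (ennreal (k powr s / 2)) (1 / s) \<le> Lq_dt_over_t q F"
      using False s unfolding Lq_dt_over_t_def s_def[symmetric] by (auto intro!: epow_mono)
    then show ?thesis
      using s k by (simp add: epow_ennreal powr_divide powr_powr)
  qed
  then show ?thesis by (intro that[of "(1 / 2) powr (1 / s)"]) auto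
qed

text \<open>For finite q the integrand is r^((1-\<theta>)q-1) up to 1, integrable at 0 as \<theta> <
  1, and r^(-\<theta>q-1) from 1 on, integrable at infinity as \<theta> > 0.\<close>

lemma Lq_powr_min_finite:
  assumes "0 < \<theta>" "\<theta> < 1" "0 < q"
  shows "Lq_dt_over_t q (\<lambda>r. ennreal (r powr (- \<theta>) * min 1 r)) < \<infinity>"
proof (cases "q = \<infinity>")
  case True
  have "r powr (- \<theta>) * min 1 r \<le> 1" if "0 < r" for r
  proof (cases "r \<le> 1")
    case True
    have "r powr (- \<theta>) * r powr 1 = r powr (1 - \<theta>)"
      unfolding powr_add[symmetric] by simp
    also have "\<dots> \<le> 1" using True assms that by (intro powr_le1) auto
    finally show ?thesis using True that by (simp add: min_def)
  next
    case False
    have "r powr (- \<theta>) \<le> 1 powr (- \<theta>)"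
      using False assms by (intro powr_mono2') auto
    then show ?thesis using False by (simp add: min_def)
  qed
  then have "Lq_dt_over_t q (\<lambda>r. ennreal (r powr (- \<theta>) * min 1 r)) \<le> 1"
    using True by (auto simp: Lq_dt_over_t_def intro!: SUP_least)
  then show ?thesis by (rule le_less_trans) simp
next
  case False
  define s where "s = enn2real q"
  have s: "0 < s"
    using assms False by (simp add: s_def enn2real_positive_iff less_top)
  define a b where "a = (1 - \<theta>) * s - 1" and "b = - \<theta> * s - 1"
  have a: "-1 < a" and b: "b < -1" using assms s by (auto simp: a_def b_def)
  have "(\<integral>\<^sup>+r\<in>{0<..}. epow (ennreal (r powr (- \<theta>) * min 1 r)) s / ennreal r \<partial>lborel)
    \<le> (\<integral>\<^sup>+r. ennreal (r powr a) * indicator {0..1} r + ennreal (r powr b) * indicator {1..} r \<partial>lborel)"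
  proof (rule nn_integral_mono)
    fix r :: real
    show "epow (ennreal (r powr (- \<theta>) * min 1 r)) s / ennreal r * indicator {0<..} r
      \<le> ennreal (r powr a) * indicator {0..1} r + ennreal (r powr b) * indicator {1..} r"
    proof (cases "0 < r")
      case True
      have eq: "epow (ennreal (r powr (- \<theta>) * min 1 r)) s / ennreal r = ennreal ((r powr (- \<theta>) * min 1 r) powr s / r)"
        using True by (simp add: epow_ennreal divide_ennreal)
      show ?thesis
      proof (cases "r \<le> 1")
        case True
        have "(r powr (- \<theta>) * r) powr s / r = ((r powr (- \<theta>) * r powr 1) powr s) / r powr 1"
          using \<open>0 < r\<close> by simp
        also have "\<dots> = r powr a"
          unfolding powr_add[symmetric] powr_powr powr_diff[symmetric] by (simp add: a_def algebra_simps)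
        finally show ?thesis
          using True \<open>0 < r\<close> unfolding eq by (simp add: min_def)
      next
        case False
        have "(r powr (- \<theta>)) powr s / r = (r powr (- \<theta>)) powr s / r powr 1"
          using \<open>0 < r\<close> by simp
        also have "\<dots> = r powr b"
          unfolding powr_powr powr_diff[symmetric] by (simp add: b_def)
        finally show ?thesis
          using False \<open>0 < r\<close> unfolding eq by (simp add: min_def)
      qed
    qed simp
  qed
  also have "\<dots> = (\<integral>\<^sup>+r. ennreal (r powr a) * indicator {0..1} r \<partial>lborel) + (\<integral>\<^sup>+r. ennreal (r powr b) * indicator {1..} r \<partial>lborel)"
    by (intro nn_integral_add) auto
  also have "\<dots> < \<infinity>"
    using nn_integral_has_integral_lebesgue'[OF _ has_integral_powr_from_0[OF a, of 1]]
      nn_integral_has_integral_lebesgue'[OF _ has_integral_powr_to_inf[OF b, of 1]] by simp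
  finally show ?thesis
    using False s by (simp add: Lq_dt_over_t_def epow_def flip: s_def)
qed

text \<open>The dilation of r by \<open>\<delta>\<close> reduces the claim to
  \<open>\<delta> = 1\<close>, and the weight r^(-\<theta>) releases the factor
  \<delta>^(-\<theta>).\<close>

lemma Lq_powr_min_scaled:
  assumes "0 < \<theta>" "\<theta> < 1" "0 < q"
  obtains J :: real where "0 < J"
    "\<And>\<delta>. 0 < \<delta> \<Longrightarrow> Lq_dt_over_t q (\<lambda>r. ennreal (r powr (- \<theta>) * min 1 (r / \<delta>))) \<le> ennreal (J * \<delta> powr (- \<theta>))"
proof -
  obtain K :: real where K: "0 < K"
    "\<And>a F. 0 < a \<Longrightarrow> Lq_dt_over_t q F \<le> ennreal K * Lq_dt_over_t q (\<lambda>r. F (a * r powr 1))"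
    by (rule Lq_substitution[OF zero_less_one assms(3)]) (rule that)
  define I where "I = Lq_dt_over_t q (\<lambda>r. ennreal (r powr (- \<theta>) * min 1 r))"
  have I: "I = ennreal (enn2real I)"
    using Lq_powr_min_finite[OF assms] by (simp add: I_def)
  \<comment> \<open>The \<open>+ 1\<close> gives positivity without a lower bound for
    \<open>I\<close>.\<close>
  define J where "J = K * (enn2real I + 1)"
  have "Lq_dt_over_t q (\<lambda>r. ennreal (r powr (- \<theta>) * min 1 (r / \<delta>))) \<le> ennreal (J * \<delta> powr (- \<theta>))" (is "Lq_dt_over_t q ?F \<le> _")
    if \<delta>: "0 < \<delta>" for \<delta>
  proof -
    have "Lq_dt_over_t q (\<lambda>r. ?F (\<delta> * r powr 1))
      \<le> Lq_dt_over_t q (\<lambda>r. ennreal (\<delta> powr (- \<theta>)) * ennreal (r powr (- \<theta>) * min 1 r))"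
      using \<delta> by (intro Lq_mono) (simp add: powr_mult mult_ac flip: ennreal_mult)
    also have "\<dots> \<le> ennreal (\<delta> powr (- \<theta>)) * I"
      unfolding I_def using \<delta> assms by (intro Lq_cmult_le) auto
    finally have "ennreal K * Lq_dt_over_t q (\<lambda>r. ?F (\<delta> * r powr 1)) \<le> ennreal K * (ennreal (\<delta> powr (- \<theta>)) * ennreal (enn2real I))"
      unfolding I[symmetric] by (rule mult_left_mono) simp
    also have "\<dots> \<le> ennreal (J * \<delta> powr (- \<theta>))"
      using K(1) by (simp flip: ennreal_mult) (simp add: J_def algebra_simps)
    finally show ?thesis using K(2)[OF \<delta>, of ?F] by (rule order_trans[rotated])
  qed
  moreover have "0 < J" using K(1) by (simp add: J_def add_nonneg_pos)
  ultimately show ?thesis using that by blast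
qed

text \<open>The support has measure at most \<open>t\<close>, so the rearrangement vanishes at
  \<open>t\<close> and the oscillation is the full mean. Since \<open>g\<close> is at least 1 on a
  set of measure \<open>a\<close>, the rearrangement is at least 1 on (0,a).\<close>

lemma osc_ge_of_indicator_bounds:
  assumes [measurable]: "g \<in> borel_measurable M" and E: "E \<in> sets M" "emeasure M E \<le> ennreal t"
    and supp: "\<And>x. x \<in> space M \<Longrightarrow> x \<notin> E \<Longrightarrow> g x = 0"
    and G: "G \<in> sets M" "ennreal a \<le> emeasure M G" "\<And>x. x \<in> G \<Longrightarrow> 1 \<le> g x"
    and a: "0 < a" "a \<le> t"
  shows "ennreal (a / t) \<le> osc M g t"
proof -
  have "emeasure M {x \<in> space M. 0 < \<bar>g x\<bar>} \<le> emeasure M E"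
    using E supp by (intro emeasure_mono) auto
  then have "rearr M g t \<le> ennreal 0"
    using E by (intro rearr_le) auto
  then have r0: "rearr M g t = 0" by simp
  have one: "1 \<le> rearr M g s" if "s < a" for s
  proof -
    have "ennreal 1 \<le> rearr M g s"
    proof (rule rearr_ge)
      fix l :: real assume "0 \<le> l" "l < 1"
      have "ennreal s < ennreal a" using that a by (intro ennreal_lessI) auto
      also have "\<dots> \<le> emeasure M G" by fact
      also have "\<dots> \<le> emeasure M {x \<in> space M. l < \<bar>g x\<bar>}"
        using G \<open>l < 1\<close> sets.sets_into_space[OF G(1)] by (intro emeasure_mono) fastforce+
      finally show "ennreal s < emeasure M {x \<in> space M. l < \<bar>g x\<bar>}" .
    qed
    then show ?thesis by simp
  qed
  have "ennreal (a / t) = (\<integral>\<^sup>+s. indicator {0<..<a} s \<partial>lborel) / ennreal t"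
    using a by (simp add: divide_ennreal)
  also have "\<dots> \<le> rearr_avg M g t"
    unfolding rearr_avg_def using one a
    by (intro divide_right_mono_ennreal nn_integral_mono) (auto simp: indicator_def)
  finally show ?thesis by (simp add: osc_def r0)
qed

section \<open>Measurability of ball integrals and the norm of averaged differences\<close>

context metric_measure_space
begin

text \<open>Openness alone would place this set in the Borel sets of the product. Separability
  writes it as a countable union of products of balls, hence in the product sigma-algebra that
  Fubini-type arguments need.\<close>

lemma dist_less_measurable: "{z. dist (fst z) (snd z) < s} \<in> sets (M \<Otimes>\<^sub>M M)"
proof -
  obtain U :: "'a set" where U: "countable U" "closure U = UNIV"
    using separable unfolding separable_space_def by auto
  have "{z. dist (fst z) (snd z) < s} = (\<Union>u\<in>U. \<Union>q\<in>\<rat>. ball u q \<times> ball u (s - q))"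
  proof (intro equalityI subsetI)
    fix z :: "'a \<times> 'a" assume "z \<in> {z. dist (fst z) (snd z) < s}"
    then obtain x y where z: "z = (x, y)" "dist x y < s" by (cases z) auto
    \<comment> \<open>Half of the slack: with \<open>dist u x < q < e\<close>, the triangle
      inequality leaves \<open>dist u y < s - e\<close>, which is below
      \<open>s - q\<close>.\<close>
    define e where "e = (s - dist x y) / 2"
    have "0 < e" using z by (simp add: e_def)
    then obtain u where u: "u \<in> U" "dist u x < e"
      using U closure_approachable[of x U] by auto
    obtain q where q: "q \<in> \<rat>" "dist u x < q" "q < e"
      using Rats_dense_in_real[OF u(2)] by auto
    have "dist u y \<le> dist u x + dist x y" by (rule dist_triangle)
    also have "\<dots> < s - q" using q(2) q(3)[unfolded e_def] by (simp add: field_simps)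
    finally show "z \<in> (\<Union>u\<in>U. \<Union>q\<in>\<rat>. ball u q \<times> ball u (s - q))"
      using z u q by auto
  next
    fix z assume "z \<in> (\<Union>u\<in>U. \<Union>q\<in>\<rat>. ball u q \<times> ball u (s - q))"
    then obtain u q where "dist u (fst z) < q" "dist u (snd z) < s - q" by auto
    moreover have "dist (fst z) (snd z) \<le> dist u (fst z) + dist u (snd z)"
      by (rule dist_triangle3)
    ultimately show "z \<in> {z. dist (fst z) (snd z) < s}" by simp
  qed
  also have "\<dots> \<in> sets (M \<Otimes>\<^sub>M M)"
  proof -
    have "(\<Union>q\<in>\<rat>. ball u q \<times> ball u (s - q)) \<in> sets (M \<Otimes>\<^sub>M M)" for u
      by (rule sets.countable_UN'[OF countable_rat]) auto
    then show ?thesis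
      using U(1) by (intro sets.countable_UN') auto
  qed
  finally show ?thesis .
qed

text \<open>The ball around \<open>x\<close> is a section of the measurable set of the preceding
  lemma, so this is an integral with a parameter. With \<open>F = 1\<close> it shows that the
  measure of a ball is measurable in its centre.\<close>

lemma ball_integral_measurable:
  assumes [measurable]: "(\<lambda>z. F (fst z) (snd z)) \<in> borel_measurable (M \<Otimes>\<^sub>M M)"
  shows "(\<lambda>x. LINT y:ball x s|M. (F x y :: real)) \<in> borel_measurable M"
proof -
  interpret sigma_finite_measure M by (rule sigma_finite)
  have [measurable]: "{z. dist (fst z) (snd z) < s} \<in> sets (M \<Otimes>\<^sub>M M)"
    by (rule dist_less_measurable)
  have "(\<lambda>x. LINT y|M. indicator {z. dist (fst z) (snd z) < s} (x, y) * F x y) \<in> borel_measurable M"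
    by (rule borel_measurable_lebesgue_integral) (simp add: case_prod_beta')
  moreover have "(LINT y:ball x s|M. F x y) = (LINT y|M. indicator {z. dist (fst z) (snd z) < s} (x, y) * F x y)" for x
    unfolding set_lebesgue_integral_def by (intro Bochner_Integration.integral_cong) (auto simp: indicator_def)
  ultimately show ?thesis by simp
qed

lemma ball_avg_bounded:
  assumes Y: "ri_space M Y N" and D: "op_norm Y N (ball_avg M s) \<le> ennreal D" "0 \<le> D"
    and h: "h \<in> Y" "0 < N h"
  shows "ball_avg M s h \<in> Y" "N (ball_avg M s h) \<le> D * N h"
proof -
  interpret Y: ri_space M Y N by fact
  define u where "u = (\<lambda>x. (1 / N h) * h x)"
  have u: "u \<in> Y" "N u = 1"
    using Y.scale_mem[OF h(1), of "1 / N h"] Y.norm_scale[OF h(1), of "1 / N h"] h by (auto simp: u_def)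
  have "ext_norm Y N (ball_avg M s u) \<le> op_norm Y N (ball_avg M s)"
    unfolding op_norm_def using u by (intro SUP_upper) auto
  also have "\<dots> \<le> ennreal D" by fact
  finally have v: "ball_avg M s u \<in> Y" "N (ball_avg M s u) \<le> D"
    using D by (auto simp: ext_norm_def top_unique split: if_splits)
  have eq: "ball_avg M s h = (\<lambda>x. N h * ball_avg M s u x)"
    using h by (auto simp: ball_avg_def u_def)
  show "ball_avg M s h \<in> Y"
    unfolding eq by (rule Y.scale_mem[OF v(1)])
  show "N (ball_avg M s h) \<le> D * N h"
    unfolding eq Y.norm_scale[OF v(1)] using v h by (simp add: mult.commute)
qed

text \<open>Outside the support of \<open>f\<close> the oscillation is an average of \<open>|f|\<^sup>p\<close>; the boundedness of the
  averaging operators replaces a doubling condition here.\<close>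

lemma norm_avg_diff_le:
  assumes X: "ri_space M X N" and Y: "ri_space M (convexify M (1 / p) X) (convexify_norm (1 / p) N)"
    and D: "op_norm (convexify M (1 / p) X) (convexify_norm (1 / p) N) (ball_avg M s) \<le> ennreal D" "0 \<le> D"
    and p: "0 < p" and s: "0 < s" and [measurable]: "f \<in> borel_measurable M"
    and E[measurable]: "E \<in> sets M" and E_pos: "0 < emeasure M E" "emeasure M E < \<infinity>"
    and supp: "\<And>x. x \<notin> E \<Longrightarrow> f x = 0"
    and \<kappa>: "0 \<le> \<kappa>" "\<And>x y. dist x y < s \<Longrightarrow> \<bar>f x - f y\<bar> \<le> \<kappa>"
  shows "avg_diff M p s f \<in> X" "N (avg_diff M p s f) \<le> \<kappa> * (1 + D) powr (1 / p) * N (indicator E)"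
proof -
  interpret X: ri_space M X N by fact
  define NY where "NY = convexify_norm (1 / p) N"
  interpret Y: ri_space M "convexify M (1 / p) X" NY using Y by (simp add: NY_def)
  have ind_powr: "(\<lambda>x. \<bar>indicator E x :: real\<bar> powr (1 / p)) = indicator E"
    by (auto simp: indicator_def)
  have EX: "indicator E \<in> X" using E E_pos by (intro X.indicator_mem)
  have EY: "indicator E \<in> convexify M (1 / p) X" using E E_pos by (intro Y.indicator_mem)
  have NE: "NY (indicator E) = N (indicator E) powr p"
    using ind_powr by (simp add: NY_def convexify_norm_def)
  \<comment> \<open>Positivity of the norm is required to normalise the indicator to the unit ball
    in \<open>ball_avg_bounded\<close>.\<close>
  have "\<not> (AE x in M. indicator E x = (0::real))"
    using E_pos AE_iff_measurable[of E M "\<lambda>x. indicator E x = (0::real)"] sets.sets_into_space[OF E]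
    by (auto simp: indicator_def Int_absorb1 Collect_conj_eq)
  then have NY_pos: "0 < NY (indicator E)"
    using Y.norm_eq_zero[OF EY] Y.norm_nonneg[OF EY] by auto
  have A: "ball_avg M s (indicator E) \<in> convexify M (1 / p) X"
      "NY (ball_avg M s (indicator E)) \<le> D * NY (indicator E)"
    using ball_avg_bounded[OF Y D] EY NY_pos by (auto simp: NY_def)
  \<comment> \<open>Majorant of the p-th power of the averaged difference: \<kappa>^p for
    \<open>x\<close> in \<open>E\<close>; for other \<open>x\<close> only the points of the ball
    inside \<open>E\<close> contribute. Membership and norm are then read off in the convexified
    space.\<close>
  define w where "w = (\<lambda>x. \<kappa> powr p * (indicator E x + ball_avg M s (indicator E) x))"
  have w: "w \<in> convexify M (1 / p) X"
    unfolding w_def using EY A by (intro Y.scale_mem Y.add_mem)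
  have "NY w \<le> \<kappa> powr p * (NY (indicator E) + D * NY (indicator E))"
    unfolding w_def using Y.norm_scale[OF Y.add_mem[OF EY A(1)], of "\<kappa> powr p"] Y.norm_triangle[OF EY A(1)] A(2)
    by (simp add: mult_left_mono)
  then have Nw: "NY w \<le> \<kappa> powr p * (1 + D) * NY (indicator E)"
    by (simp add: algebra_simps)
  define v where "v = (\<lambda>x. (LINT y:ball x s|M. \<bar>f x - f y\<bar> powr p) / measure M (ball x s))"
  have "(\<lambda>x. LINT y:ball x s|M. (1::real)) \<in> borel_measurable M"
    by (intro ball_integral_measurable) auto
  then have [measurable]: "(\<lambda>x. measure M (ball x s)) \<in> borel_measurable M"
    by (simp add: set_lebesgue_integral_def)
  have [measurable]: "v \<in> borel_measurable M"
    unfolding v_def by (intro borel_measurable_divide ball_integral_measurable) auto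
  have v0: "0 \<le> v x" for x
    unfolding v_def set_lebesgue_integral_def
    by (intro divide_nonneg_nonneg Bochner_Integration.integral_nonneg) auto
  have vw: "v x \<le> w x" for x
  proof -
    define B where "B = ball x s"
    have B: "emeasure M B = ennreal (measure M B)" "0 < measure M B" "B \<in> sets M"
      using emeasure_ball[OF s] by (auto simp: B_def)
    have int1: "integrable M (\<lambda>y. indicator B y * (\<kappa> powr p * indicator E x) :: real)"
      using B by (intro integrable_mult_left) auto
    have int2: "integrable M (\<lambda>y. indicator B y * indicator E y :: real)"
      unfolding indicator_inter_arith[symmetric] using B emeasure_mono[of "B \<inter> E" B M]
      by (intro integrable_real_indicator) (auto intro: le_less_trans)
    have int: "integrable M (\<lambda>y. indicator B y * (\<kappa> powr p * indicator E x) + \<kappa> powr p * (indicator B y * indicator E y))"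
      by (intro Bochner_Integration.integrable_add integrable_mult_right int1 int2)
    have bound: "indicator B y *\<^sub>R \<bar>f x - f y\<bar> powr p \<le> indicator B y * (\<kappa> powr p * indicator E x) + \<kappa> powr p * (indicator B y * indicator E y)" for y
    proof (cases "y \<in> B \<and> (x \<in> E \<or> y \<in> E)")
      case True
      then have "\<bar>f x - f y\<bar> powr p \<le> \<kappa> powr p"
        using p \<kappa>(2)[of x y] by (intro powr_mono2) (auto simp: B_def)
      moreover have "0 \<le> \<kappa> powr p" by simp
      ultimately show ?thesis using True by (auto simp: indicator_def simp del: powr_ge_zero)
    next
      case False
      then show ?thesis using supp p by (auto simp: indicator_def)
    qed
    have "(LINT y:B|M. \<bar>f x - f y\<bar> powr p) \<le> (LINT y|M. indicator B y * (\<kappa> powr p * indicator E x) + \<kappa> powr p * (indicator B y * indicator E y))"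
      unfolding set_lebesgue_integral_def
    proof (rule integral_mono[OF _ int bound])
      show "integrable M (\<lambda>y. indicator B y *\<^sub>R \<bar>f x - f y\<bar> powr p)"
        using B bound by (intro Bochner_Integration.integrable_bound[OF int]) (auto intro: order_trans[OF _ abs_ge_self])
    qed
    also have "\<dots> = \<kappa> powr p * indicator E x * measure M B + \<kappa> powr p * (LINT y:B|M. indicator E y)"
      using B int1 int2 by (simp add: set_lebesgue_integral_def)
    finally have "v x \<le> (\<kappa> powr p * indicator E x * measure M B + \<kappa> powr p * (LINT y:B|M. indicator E y)) / measure M B"
      unfolding v_def B_def[symmetric] using B by (intro divide_right_mono) auto
    also have "\<dots> = w x"
      using B by (simp add: w_def ball_avg_def flip: B_def) (simp add: field_simps)
    finally show ?thesis .
  qed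
  have v: "v \<in> convexify M (1 / p) X" "NY v \<le> NY w"
    using v0 vw by (intro conjunct1[OF Y.lattice[OF _ w]] conjunct2[OF Y.lattice[OF _ w]]; auto intro: order_trans[OF _ abs_ge_self])+
  have eq: "avg_diff M p s f = (\<lambda>x. \<bar>v x\<bar> powr (1 / p))"
    unfolding abs_of_nonneg[OF v0] by (simp add: avg_diff_def v_def fun_eq_iff)
  show mem: "avg_diff M p s f \<in> X"
    unfolding eq using v by (simp add: convexify_def)
  have "N (avg_diff M p s f) powr p = NY v"
    by (simp add: eq NY_def convexify_norm_def)
  also have "\<dots> \<le> \<kappa> powr p * (1 + D) * N (indicator E) powr p"
    using v(2) Nw by (simp add: NE)
  finally have "(N (avg_diff M p s f) powr p) powr (1 / p) \<le> (\<kappa> powr p * (1 + D) * N (indicator E) powr p) powr (1 / p)"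
    using p by (intro powr_mono2) auto
  then show "N (avg_diff M p s f) \<le> \<kappa> * (1 + D) powr (1 / p) * N (indicator E)"
    using p D \<kappa> X.norm_nonneg[OF mem] X.norm_nonneg[OF EX] by (simp add: powr_mult powr_powr)
qed

end

section \<open>Radii that halve the measure of a ball, and the lower bound for ball measures\<close>

context metric_measure_space
begin

lemma measure_ball_tendsto:
  assumes "\<And>n. u n < R" "u \<longlonglongrightarrow> R" "incseq u" "0 < R"
  shows "(\<lambda>n. measure M (ball x (u n))) \<longlonglongrightarrow> measure M (ball x R)"
proof -
  have "ball x R = (\<Union>n. ball x (u n))"
  proof (intro equalityI subsetI)
    fix y assume "y \<in> ball x R"
    then have "eventually (\<lambda>n. dist x y < u n) sequentially"
      using order_tendstoD(1)[OF assms(2)] by auto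
    then show "y \<in> (\<Union>n. ball x (u n))" by (auto dest: eventually_happens)
  next
    fix y assume "y \<in> (\<Union>n. ball x (u n))"
    then obtain n where "dist x y < u n" by auto
    then show "y \<in> ball x R" using assms(1)[of n] by auto
  qed
  moreover have "(\<lambda>n. measure M (ball x (u n))) \<longlonglongrightarrow> measure M (\<Union>n. ball x (u n))"
  proof (rule Lim_measure_incseq)
    show "incseq (\<lambda>n. ball x (u n))"
      using assms(3) by (simp add: incseq_def subset_ball)
    show "emeasure M (\<Union>n. ball x (u n)) \<noteq> \<infinity>"
      unfolding \<open>ball x R = (\<Union>n. ball x (u n))\<close>[symmetric] using ball_finite[OF assms(4), of x] by simp
  qed auto
  ultimately show ?thesis by simp
qed

lemma measure_cball_tendsto:
  assumes "\<And>n. R < u n" "u \<longlonglongrightarrow> R" "decseq u" "0 \<le> R"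
  shows "(\<lambda>n. measure M (ball x (u n))) \<longlonglongrightarrow> measure M (cball x R)"
proof -
  have "cball x R = (\<Inter>n. ball x (u n))"
  proof (intro equalityI subsetI)
    fix y assume "y \<in> cball x R"
    then show "y \<in> (\<Inter>n. ball x (u n))"
      using assms(1) by (auto intro: le_less_trans)
  next
    fix y assume "y \<in> (\<Inter>n. ball x (u n))"
    then have "dist x y \<le> u n" for n by (auto simp: less_imp_le)
    then have "dist x y \<le> R"
      by (intro LIMSEQ_le_const[OF assms(2)]) auto
    then show "y \<in> cball x R" by simp
  qed
  moreover have "(\<lambda>n. measure M (ball x (u n))) \<longlonglongrightarrow> measure M (\<Inter>n. ball x (u n))"
  proof (rule Lim_measure_decseq)
    show "decseq (\<lambda>n. ball x (u n))"
      using assms(3) by (simp add: decseq_def subset_ball)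
    show "emeasure M (ball x (u n)) \<noteq> \<infinity>" for n
      using ball_finite[of "u n" x] assms(1)[of n] assms(4) by simp
  qed auto
  ultimately show ?thesis by simp
qed

lemma measure_ball_mono:
  assumes "s \<le> r"
  shows "measure M (ball x s) \<le> measure M (ball x r)"
proof (cases "0 < r")
  case True
  then show ?thesis
    using ball_finite[OF True, of x] assms by (intro measure_mono_fmeasurable fmeasurableI) auto
next
  case False
  then have "ball x s = {}" using assms by simp
  then show ?thesis by (simp only: measure_empty measure_nonneg)
qed

text \<open>\<open>\<rho>\<close> is the supremum of the radii whose open ball has at most half of
  the measure. Approaching it from the left bounds the open ball; larger radii exceed one half, and
  approaching from the right bounds the closed ball. It is positive because points are null
  sets.\<close>

lemma exists_halving_radius:
  assumes R: "0 < R"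
  obtains \<rho> where "0 < \<rho>" "\<rho> < R" "measure M (ball x \<rho>) \<le> measure M (ball x R) / 2"
    "measure M (ball x R) / 2 \<le> measure M (cball x \<rho>)"
proof -
  define m where "m = (\<lambda>s. measure M (ball x s))"
  have m: "0 < m R" using emeasure_ball(2)[OF R] by (simp add: m_def)
  have m_mono: "m s \<le> m r" if "s \<le> r" for s r
    using measure_ball_mono[OF that] by (simp add: m_def)
  define S where "S = {s. 0 < s \<and> s \<le> R \<and> m s \<le> m R / 2}"
  have "(\<lambda>n. m (1 / real (Suc n))) \<longlonglongrightarrow> measure M (cball x 0)"
    unfolding m_def by (rule measure_cball_tendsto) (auto simp: decseq_def field_simps, real_asymp)
  then have "(\<lambda>n. m (1 / real (Suc n))) \<longlonglongrightarrow> 0"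
    using emeasure_singleton[of x] by (simp add: measure_def)
  then have "eventually (\<lambda>n. m (1 / real (Suc n)) < m R / 2) sequentially"
    using m by (intro order_tendstoD) auto
  then obtain n where n: "m (1 / real (Suc n)) < m R / 2"
    by (auto dest: eventually_happens)
  \<comment> \<open>This radius is at most \<open>R\<close>, since otherwise its ball would have at
    least the measure of the ball of radius \<open>R\<close>.\<close>
  then have S0: "1 / real (Suc n) \<in> S"
    using m m_mono[of R "1 / real (Suc n)"] by (auto simp: S_def simp del: of_nat_Suc intro: ccontr)
  have bdd: "bdd_above S" by (auto simp: S_def bdd_above_def)
  define \<rho> where "\<rho> = Sup S"
  have "0 < 1 / real (Suc n)" by simp
  also have "1 / real (Suc n) \<le> \<rho>"
    unfolding \<rho>_def by (rule cSup_upper[OF S0 bdd])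
  finally have "0 < \<rho>" .
  moreover have "\<rho> \<le> R"
    unfolding \<rho>_def using S0 by (intro cSup_least) (auto simp: S_def)
  ultimately have \<rho>: "0 < \<rho>" "\<rho> \<le> R" .
  have small: "m \<rho> \<le> m R / 2"
  proof -
    have "(\<lambda>n. m (\<rho> - \<rho> / real (Suc n))) \<longlonglongrightarrow> m \<rho>"
      unfolding m_def
    proof (rule measure_ball_tendsto)
      show "(\<lambda>n. \<rho> - \<rho> / real (Suc n)) \<longlonglongrightarrow> \<rho>" by real_asymp
      show "incseq (\<lambda>n. \<rho> - \<rho> / real (Suc n))"
        using \<rho> by (intro incseq_SucI diff_mono divide_left_mono) auto
    qed (use \<rho> in auto)
    moreover have "m (\<rho> - \<rho> / real (Suc n)) \<le> m R / 2" for n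
    proof -
      have "\<rho> - \<rho> / real (Suc n) < Sup S" using \<rho> by (simp add: \<rho>_def[symmetric])
      then obtain s where "s \<in> S" "\<rho> - \<rho> / real (Suc n) < s"
        using less_cSup_iff[OF _ bdd] S0 by auto
      then show ?thesis
        using m_mono[of "\<rho> - \<rho> / real (Suc n)" s] by (auto simp: S_def)
    qed
    ultimately show ?thesis by (intro LIMSEQ_le_const2) auto
  qed
  then have "\<rho> < R" using \<rho> m by (cases "\<rho> = R") auto
  have "(\<lambda>n. m (\<rho> + 1 / real (Suc n))) \<longlonglongrightarrow> measure M (cball x \<rho>)"
    unfolding m_def
  proof (rule measure_cball_tendsto)
    show "(\<lambda>n. \<rho> + 1 / real (Suc n)) \<longlonglongrightarrow> \<rho>" by real_asymp
    show "decseq (\<lambda>n. \<rho> + 1 / real (Suc n))"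
      by (intro decseq_SucI add_mono divide_left_mono) auto
  qed (use \<rho> in auto)
  moreover have "m R / 2 \<le> m (\<rho> + 1 / real (Suc n))" for n
  proof (rule ccontr)
    assume less: "\<not> m R / 2 \<le> m (\<rho> + 1 / real (Suc n))"
    then have "\<rho> + 1 / real (Suc n) \<le> R"
      using m_mono[of R "\<rho> + 1 / real (Suc n)"] m by (cases "\<rho> + 1 / real (Suc n) \<le> R") (auto simp del: of_nat_Suc)
    moreover have "0 < \<rho> + 1 / real (Suc n)"
      using \<rho> by (intro add_pos_pos) auto
    ultimately have "\<rho> + 1 / real (Suc n) \<in> S"
      using less by (auto simp: S_def)
    then have "\<rho> + 1 / real (Suc n) \<le> \<rho>"
      unfolding \<rho>_def by (intro cSup_upper bdd)
    then show False by simp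
  qed
  ultimately have "m R / 2 \<le> measure M (cball x \<rho>)"
    by (intro LIMSEQ_le_const) auto
  then show ?thesis
    using that[of \<rho>] \<rho> \<open>\<rho> < R\<close> small by (simp add: m_def)
qed

text \<open>The radii are halved in measure rather than in length, so no doubling condition is needed. If the
  claim fails at \<open>R\<close>, then a positive lower bound for \<open>s - C' \<mu>(B(x,s))\<^sup>1\<^sup>/\<^sup>Q\<close> persists from each radius to
  its halving radius; these radii then stay bounded below although the measures of the balls can be
  halved again and again.\<close>

lemma radius_le_of_halving:
  assumes C: "0 < C" and Q: "0 < Q" and R: "0 < R"
    and step: "\<And>R \<rho>. 0 < \<rho> \<Longrightarrow> \<rho> < R \<Longrightarrow> measure M (ball x R) / 2 \<le> measure M (cball x \<rho>) \<Longrightarrow>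
      R - \<rho> \<le> C * measure M (ball x R) powr (1 / Q)"
  shows "R \<le> C / (1 - (1 / 2) powr (1 / Q)) * measure M (ball x R) powr (1 / Q)"
proof (rule ccontr)
  define m where "m = (\<lambda>s. measure M (ball x s))"
  define k :: real where "k = (1 / 2) powr (1 / Q)"
  have "k < 1 powr (1 / Q)" unfolding k_def using Q by (intro powr_less_mono2) auto
  then have k: "k < 1" by simp
  \<comment> \<open>The fixed point of \<open>C' = C + C' * k\<close>: the loss
    \<open>C * m s powr (1 / Q)\<close> in radius is balanced by the decrease of the subtracted term
    under halving, so the defect \<open>e\<close> persists.\<close>
  define C' where "C' = C / (1 - k)"
  have C': "0 < C'" "C' = C + C' * k" using C k by (auto simp: C'_def field_simps)
  define e where "e = R - C' * m R powr (1 / Q)"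
  assume "\<not> R \<le> C / (1 - (1 / 2) powr (1 / Q)) * measure M (ball x R) powr (1 / Q)"
  then have e: "0 < e" by (simp add: e_def C'_def k_def m_def)
  define S where "S = {s. 0 < s \<and> e \<le> s - C' * m s powr (1 / Q)}"
  have RS: "R \<in> S" using R by (simp add: S_def e_def)
  have next_S: "\<exists>\<rho>\<in>S. m \<rho> \<le> m s / 2" if "s \<in> S" for s
  proof -
    have s: "0 < s" "e \<le> s - C' * m s powr (1 / Q)" using that by (auto simp: S_def)
    obtain \<rho> where \<rho>: "0 < \<rho>" "\<rho> < s" "m \<rho> \<le> m s / 2" "m s / 2 \<le> measure M (cball x \<rho>)"
      using exists_halving_radius[OF s(1), of x] by (auto simp: m_def)
    have "m \<rho> powr (1 / Q) \<le> (m s / 2) powr (1 / Q)"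
      using \<rho> Q by (intro powr_mono2) (auto simp: m_def)
    also have "\<dots> = k * m s powr (1 / Q)"
      by (simp add: k_def powr_divide)
    finally have "C' * m \<rho> powr (1 / Q) \<le> C' * k * m s powr (1 / Q)"
      using C' by (simp add: mult.assoc)
    moreover have "s - \<rho> \<le> C * m s powr (1 / Q)"
      using step[OF \<rho>(1,2)] \<rho>(4) by (simp add: m_def)
    moreover have "C' * m s powr (1 / Q) = C * m s powr (1 / Q) + C' * k * m s powr (1 / Q)"
      by (subst C'(2)) (simp add: algebra_simps)
    ultimately have "\<rho> \<in> S" using s \<rho>(1) by (simp add: S_def)
    then show ?thesis using \<rho> by auto
  qed
  have low: "m e \<le> m s" if "s \<in> S" for s
  proof -
    have "0 \<le> C' * m s powr (1 / Q)" using C' by simp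
    then have "e \<le> s" using that by (auto simp: S_def)
    then show ?thesis by (simp add: m_def measure_ball_mono)
  qed
  have me: "0 < m e" using emeasure_ball(2)[OF e] by (simp add: m_def)
  \<comment> \<open>The infimum is positive because all radii in \<open>S\<close> are at least
    \<open>e\<close>. A radius with measure below \<open>2 * I\<close> has a halving radius in
    \<open>S\<close> with measure below \<open>I\<close>, which is impossible.\<close>
  define I where "I = Inf (m ` S)"
  have bdd: "bdd_below (m ` S)" using low by (auto simp: bdd_below_def)
  have "m e \<le> I" unfolding I_def using RS low by (intro cInf_greatest) auto
  then have "I < 2 * I" using me by simp
  then obtain s where s: "s \<in> S" "m s < 2 * I"
    using cInf_less_iff[of "m ` S" "2 * I"] bdd RS unfolding I_def by auto
  then obtain \<rho> where "\<rho> \<in> S" "m \<rho> \<le> m s / 2" using next_S by auto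
  moreover from this have "I \<le> m \<rho>" unfolding I_def by (intro cInf_lower bdd) auto
  ultimately show False using s by simp
qed

text \<open>At distance below r the values differ by at most 1, as they lie in the unit interval,
  and by at most r/\<delta> by the Lipschitz bound. \<open>norm_avg_diff_le\<close> with this
  minimum separates the dependence on r from the norm of the indicator.\<close>

lemma besov_seminorm_cutoff_le:
  assumes X: "ri_space M X N" and Y: "ri_space M (convexify M (1 / p) X) (convexify_norm (1 / p) N)"
    and D: "D_const M X N p \<le> ennreal D" "0 \<le> D" and p: "0 < p" and q: "0 < q" and \<delta>: "0 < \<delta>"
    and f[measurable]: "f \<in> borel_measurable M" and f_le: "\<And>x. \<bar>f x\<bar> \<le> 1"
    and lip: "\<And>x y. \<bar>f x - f y\<bar> \<le> dist x y / \<delta>"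
    and E: "E \<in> sets M" "0 < emeasure M E" "emeasure M E < \<infinity>" and supp: "\<And>x. x \<notin> E \<Longrightarrow> f x = 0"
    and f0: "\<And>x. 0 \<le> f x"
    and J: "Lq_dt_over_t q (\<lambda>r. ennreal (r powr (- \<theta>) * min 1 (r / \<delta>))) \<le> ennreal (J * \<delta> powr (- \<theta>))" "0 < J"
    and NE: "0 < N (indicator E)"
  shows "besov_seminorm M X N \<theta> p q f \<le> ennreal ((1 + D) powr (1 / p) * N (indicator E) * (J * \<delta> powr (- \<theta>)))"
proof -
  interpret X: ri_space M X N by fact
  define A where "A = (1 + D) powr (1 / p) * N (indicator E)"
  have A: "0 < A" using D NE by (simp add: A_def)
  have f_loc: "f \<in> Lp_loc M p"
    unfolding Lp_loc_def
  proof (safe intro!: f)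
    fix x and r :: real assume r: "0 < r"
    have "integrable M (\<lambda>y. indicator (ball x r) y * 1 :: real)"
      using ball_finite[OF r, of x] by simp
    then show "set_integrable M (ball x r) (\<lambda>y. \<bar>f y\<bar> powr p)"
      unfolding set_integrable_def
    proof (rule Bochner_Integration.integrable_bound)
      show "(\<lambda>y. indicator (ball x r) y *\<^sub>R \<bar>f y\<bar> powr p) \<in> borel_measurable M" by measurable
    qed (use f_le p in \<open>auto simp: indicator_def powr_le1\<close>)
  qed
  have "ennreal (r powr (- \<theta>)) * smoothness_modulus M X N p f r \<le> ennreal A * ennreal (r powr (- \<theta>) * min 1 (r / \<delta>))"
    if r: "0 < r" for r
  proof -
    have "op_norm (convexify M (1 / p) X) (convexify_norm (1 / p) N) (ball_avg M r) \<le> D_const M X N p"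
      unfolding D_const_def using r by (intro SUP_upper) auto
    then have D': "op_norm (convexify M (1 / p) X) (convexify_norm (1 / p) N) (ball_avg M r) \<le> ennreal D"
      by (rule order_trans[OF _ D(1)])
    have \<kappa>: "\<bar>f x - f y\<bar> \<le> min 1 (r / \<delta>)" if "dist x y < r" for x y
    proof -
      have "dist x y / \<delta> \<le> r / \<delta>" using that \<delta> by (intro divide_right_mono) auto
      then show ?thesis
        using lip[of x y] f_le[of x] f_le[of y] f0[of x] f0[of y] by auto
    qed
    have "0 \<le> min 1 (r / \<delta>)" using r \<delta> by simp
    from norm_avg_diff_le[OF X Y D' D(2) p r f E supp this \<kappa>]
    have "avg_diff M p r f \<in> X" "N (avg_diff M p r f) \<le> min 1 (r / \<delta>) * (1 + D) powr (1 / p) * N (indicator E)"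
      by auto
    then have "smoothness_modulus M X N p f r \<le> ennreal (A * min 1 (r / \<delta>))"
      by (auto simp: smoothness_modulus_def ext_norm_def A_def mult_ac intro!: ennreal_leI)
    then have "ennreal (r powr (- \<theta>)) * smoothness_modulus M X N p f r \<le> ennreal (r powr (- \<theta>)) * ennreal (A * min 1 (r / \<delta>))"
      by (intro mult_left_mono) auto
    also have "\<dots> = ennreal A * ennreal (r powr (- \<theta>) * min 1 (r / \<delta>))"
      using A r \<delta> by (simp add: mult_ac flip: ennreal_mult)
    finally show ?thesis .
  qed
  then have "Lq_dt_over_t q (\<lambda>r. ennreal (r powr (- \<theta>)) * smoothness_modulus M X N p f r)
      \<le> Lq_dt_over_t q (\<lambda>r. ennreal A * ennreal (r powr (- \<theta>) * min 1 (r / \<delta>)))"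
    by (rule Lq_mono)
  also have "\<dots> \<le> ennreal A * ennreal (J * \<delta> powr (- \<theta>))"
    by (rule order_trans[OF Lq_cmult_le[OF A q]]) (intro mult_left_mono J, simp)
  also have "\<dots> = ennreal (A * (J * \<delta> powr (- \<theta>)))"
    using A J by (simp add: ennreal_mult)
  finally show ?thesis
    using f_loc by (simp add: besov_seminorm_def A_def)
qed

lemma fundamental_mono:
  assumes X: "ri_space M X N" and st: "0 \<le> s" "s \<le> t"
  shows "fundamental M N s \<le> fundamental M N t"
proof -
  interpret X: ri_space M X N by fact
  obtain E where E: "E \<in> sets M" "emeasure M E = ennreal s"
    using exists_superset[of "{}" s] st by auto
  then obtain F where F: "F \<in> sets M" "E \<subseteq> F" "emeasure M F = ennreal t"
    using exists_superset[of E t] st by (auto simp: ennreal_leI)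
  have "fundamental M N s = N (indicator E)"
    using E by (intro X.fundamental_eq)
  also have "\<dots> \<le> N (indicator F)"
    using E F by (intro conjunct2[OF X.lattice] X.indicator_mem) (auto simp: indicator_def)
  also have "\<dots> = fundamental M N t"
    using F by (intro X.fundamental_eq[symmetric])
  finally show ?thesis .
qed

lemma lower_bound_if_oscillation_inequality:
  assumes X: "ri_space M X N" and Y: "ri_space M (convexify M (1 / p) X) (convexify_norm (1 / p) N)"
    and D: "D_const M X N p < \<infinity>" and Q: "0 < Q" and \<theta>: "0 < \<theta>" "\<theta> < 1"
    and p: "0 < p" "p0 = min 1 p" and q: "0 < q" and C: "0 < C"
    and ineq: "\<And>f. f \<in> borel_measurable M \<Longrightarrow> (\<lambda>x. \<bar>f x\<bar> powr p0) \<in> L1_plus_Linf M \<Longrightarrow>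
     Lq_dt_over_t q (\<lambda>t. ennreal (fundamental M N t * t powr (- (\<theta> / Q))) *
        epow (osc M (\<lambda>x. \<bar>f x\<bar> powr p0) t) (1 / p0)) \<le> ennreal C * besov_seminorm M X N \<theta> p q f"
  shows "\<exists>c::real. 0 < c \<and> (\<forall>r>0. ennreal (c * r powr Q) \<le> ball_growth M r)"
proof -
  interpret X: ri_space M X N by fact
  have p0: "0 < p0" using p by auto
  define d where "d = enn2real (D_const M X N p)"
  have d: "D_const M X N p \<le> ennreal d" "0 \<le> d" using D by (auto simp: d_def)
  obtain J where J: "0 < J" "\<And>\<delta>. 0 < \<delta> \<Longrightarrow>
      Lq_dt_over_t q (\<lambda>r. ennreal (r powr (- \<theta>) * min 1 (r / \<delta>))) \<le> ennreal (J * \<delta> powr (- \<theta>))"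
    by (rule Lq_powr_min_scaled[OF \<theta> q]) (rule that)
  obtain L where L: "0 < L"
    "\<And>F m k. 0 < m \<Longrightarrow> 0 \<le> k \<Longrightarrow> (\<And>t. m \<le> t \<Longrightarrow> t \<le> 2 * m \<Longrightarrow> ennreal k \<le> F t) \<Longrightarrow> ennreal (L * k) \<le> Lq_dt_over_t q F"
    using Lq_ge_of_ge_on_octave[OF q] by metis
  \<comment> \<open>\<open>a\<close> and \<open>b\<close> are the constants of the lower and the
    upper estimate for the cutoff once the indicator norm and the powers of \<open>m\<close> and
    \<open>\<delta>\<close> are split off.\<close>
  define a where "a = L * (2 powr (- (\<theta> / Q)) * (1 / 4) powr (1 / p0))"
  define b where "b = C * (1 + d) powr (1 / p) * J"
  have ab: "0 < a" "0 < b" using L C J d by (auto simp: a_def b_def)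
  define K where "K = (b / a) powr (1 / \<theta>)"
  have K: "0 < K" using ab by (simp add: K_def)
  \<comment> \<open>\<open>K\<close> depends neither on the centre nor on the radii, as the
    iteration in \<open>radius_le_of_halving\<close> requires.\<close>
  have step: "R - \<rho> \<le> K * measure M (ball x R) powr (1 / Q)"
    if \<rho>: "0 < \<rho>" "\<rho> < R" and half: "measure M (ball x R) / 2 \<le> measure M (cball x \<rho>)" for x R \<rho>
  proof -
    define \<delta> where "\<delta> = R - \<rho>"
    have \<delta>: "0 < \<delta>" using \<rho> by (simp add: \<delta>_def)
    define m where "m = measure M (ball x R)"
    define E where "E = ball x R"
    have m: "0 < m" "emeasure M E = ennreal m" using emeasure_ball[of R x] \<rho> by (auto simp: m_def E_def)
    have E[measurable]: "E \<in> sets M" by (simp add: E_def)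
    have EX: "indicator E \<in> X" using m by (intro X.indicator_mem) auto
    have "\<not> (AE x in M. indicator E x = (0::real))"
      using m AE_iff_measurable[of E M "\<lambda>x. indicator E x = (0::real)"] sets.sets_into_space[OF E]
      by (auto simp: indicator_def Int_absorb1 Collect_conj_eq)
    then have NE: "0 < N (indicator E)"
      using X.norm_eq_zero[OF EX] X.norm_nonneg[OF EX] by auto
    define f where "f = (\<lambda>y. max 0 (min 1 ((R - dist x y) / \<delta>)))"
    have "continuous_on UNIV f"
      unfolding f_def using \<delta> by (intro continuous_intros) auto
    then have f[measurable]: "f \<in> borel_measurable M"
      using borel_measurable_continuous_onI[of f] measurable_cong_sets[OF borel_measure refl] by blast
    have f01: "0 \<le> f y" "f y \<le> 1" for y by (auto simp: f_def)
    have supp: "f y = 0" if "y \<notin> E" for y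
      using that \<delta> by (auto simp: f_def E_def divide_le_0_iff)
    have one: "f y = 1" if "y \<in> cball x \<rho>" for y
      using that \<delta> by (auto simp: f_def \<delta>_def)
    have lip: "\<bar>f y - f z\<bar> \<le> dist y z / \<delta>" for y z
    proof -
      have "\<bar>f y - f z\<bar> \<le> \<bar>(R - dist x y) / \<delta> - (R - dist x z) / \<delta>\<bar>"
        by (auto simp: f_def)
      also have "\<dots> = \<bar>dist x z - dist x y\<bar> / \<delta>"
        using \<delta> by (simp add: diff_divide_distrib[symmetric])
      also have "\<dots> \<le> dist y z / \<delta>"
        using \<delta> dist_triangle[of x z y] dist_triangle[of x y z] by (intro divide_right_mono) (auto simp: dist_commute)
      finally show ?thesis .
    qed
    define g where "g = (\<lambda>y. \<bar>f y\<bar> powr p0)"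
    have [measurable]: "g \<in> borel_measurable M" unfolding g_def by measurable
    have g01: "0 \<le> g y" "g y \<le> 1" for y using f01[of y] p0 by (auto simp: g_def powr_le1)
    have "L1_norm M g \<le> (\<integral>\<^sup>+y. indicator E y \<partial>M)"
      unfolding L1_norm_def using g01 supp p0 by (intro nn_integral_mono) (auto simp: indicator_def g_def)
    also have "\<dots> < \<infinity>" using m by simp
    finally have gL1: "g \<in> L1 M" by (simp add: L1_def)
    have "Linf_norm M (\<lambda>x. 0) \<le> 0" unfolding Linf_norm_def by (intro esssup_I) auto
    then have "(\<lambda>x. 0) \<in> Linf M" by (simp add: Linf_def)
    then have sum: "g \<in> L1_plus_Linf M"
      unfolding L1_plus_Linf_def using gL1 by (intro CollectI exI[of _ g] exI[of _ "\<lambda>x. 0"]) auto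
    \<comment> \<open>Lower bound for the integrand on [m, 2m]: the oscillation is at least (m/2)/t,
      hence at least 1/4, the fundamental function is at least its value at \<open>m\<close>, and
      the decreasing weight is smallest at \<open>2 * m\<close>.\<close>
    define k where "k = N (indicator E) * (2 * m) powr (- (\<theta> / Q)) * (1 / 4) powr (1 / p0)"
    have "ennreal k \<le> ennreal (fundamental M N t * t powr (- (\<theta> / Q))) * epow (osc M g t) (1 / p0)"
      if t: "m \<le> t" "t \<le> 2 * m" for t
    proof -
      have "ennreal (m / 2) \<le> emeasure M (cball x \<rho>)"
        using half emeasure_eq_ennreal_measure[of M "cball x \<rho>"] emeasure_mono[of "cball x \<rho>" E M] m \<rho> E
        by (cases "emeasure M (cball x \<rho>) = top") (auto simp: m_def intro!: ennreal_leI)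
      then have "ennreal (m / 2 / t) \<le> osc M g t"
        using m t supp one p0 borel_measure
        by (intro osc_ge_of_indicator_bounds[of g M E t "cball x \<rho>"]) (auto simp: g_def intro: ennreal_leI)
      moreover have "1 / 4 \<le> m / 2 / t" using m t by (simp add: field_simps)
      ultimately have "ennreal (1 / 4) \<le> osc M g t"
        using ennreal_leI order_trans by blast
      then have "epow (ennreal (1 / 4)) (1 / p0) \<le> epow (osc M g t) (1 / p0)"
        using p0 by (intro epow_mono) auto
      then have o: "ennreal ((1 / 4) powr (1 / p0)) \<le> epow (osc M g t) (1 / p0)"
        by (simp add: epow_ennreal)
      have "N (indicator E) \<le> fundamental M N t"
        using m t E by (intro fundamental_ge(1)[OF X]) (auto intro: ennreal_leI fundamental_mono[OF X])
      moreover have "(2 * m) powr (- (\<theta> / Q)) \<le> t powr (- (\<theta> / Q))"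
        using m t \<theta> Q by (intro powr_mono2') auto
      ultimately have "N (indicator E) * (2 * m) powr (- (\<theta> / Q)) \<le> fundamental M N t * t powr (- (\<theta> / Q))"
        using NE by (intro mult_mono) auto
      then have "ennreal (N (indicator E) * (2 * m) powr (- (\<theta> / Q))) * ennreal ((1 / 4) powr (1 / p0))
        \<le> ennreal (fundamental M N t * t powr (- (\<theta> / Q))) * epow (osc M g t) (1 / p0)"
        by (rule mult_mono[OF ennreal_leI o]) auto
      then show ?thesis
        using NE by (simp add: k_def ennreal_mult)
    qed
    then have "ennreal (L * k) \<le> Lq_dt_over_t q (\<lambda>t. ennreal (fundamental M N t * t powr (- (\<theta> / Q))) * epow (osc M g t) (1 / p0))"
      using m NE by (intro L(2)) (auto simp: k_def)
    also have "\<dots> \<le> ennreal C * besov_seminorm M X N \<theta> p q f"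
      using ineq[OF f] sum by (simp add: g_def)
    also have "\<dots> \<le> ennreal C * ennreal ((1 + d) powr (1 / p) * N (indicator E) * (J * \<delta> powr (- \<theta>)))"
      using f01 m lip supp
      by (intro mult_left_mono besov_seminorm_cutoff_le[OF X Y d p(1) q \<delta> f _ lip E _ _ supp _ J(2)[OF \<delta>] J(1) NE]) auto
    also have "\<dots> = ennreal (b * \<delta> powr (- \<theta>) * N (indicator E))"
      using C d J NE by (simp add: b_def mult_ac flip: ennreal_mult)
    finally have "L * k \<le> b * \<delta> powr (- \<theta>) * N (indicator E)"
      using ab NE by (simp add: ennreal_le_iff)
    moreover have "L * k = a * m powr (- (\<theta> / Q)) * N (indicator E)"
      using m by (simp add: k_def a_def powr_mult)
    \<comment> \<open>The indicator norm is positive and cancels; the powers of \<open>m\<close> and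
      \<open>\<delta>\<close> that remain determine the bound for \<open>\<delta>\<close>.\<close>
    ultimately have "a * m powr (- (\<theta> / Q)) \<le> b * \<delta> powr (- \<theta>)"
      using NE by simp
    then have "\<delta> powr \<theta> \<le> b / a * m powr (\<theta> / Q)"
      using ab m \<delta> by (simp add: powr_minus field_simps)
    then have "(\<delta> powr \<theta>) powr (1 / \<theta>) \<le> (b / a * m powr (\<theta> / Q)) powr (1 / \<theta>)"
      using \<theta> by (intro powr_mono2) auto
    also have "\<dots> = K * m powr (1 / Q)"
      unfolding K_def powr_mult powr_powr using \<theta> by simp
    also have "(\<delta> powr \<theta>) powr (1 / \<theta>) = \<delta>"
      using \<theta> \<delta> by (simp add: powr_powr)
    finally show ?thesis by (simp add: \<delta>_def m_def)
  qed
  define k where "k = K / (1 - (1 / 2) powr (1 / Q))"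
  have "(1 / 2) powr (1 / Q) < 1 powr (1 / Q)" using Q by (intro powr_less_mono2) auto
  then have k: "0 < k" using K by (simp add: k_def)
  have "ennreal (k powr (- Q) * R powr Q) \<le> ball_growth M R" if R: "0 < R" for R
    unfolding ball_growth_def
  proof (rule INF_greatest)
    fix x
    have "R \<le> k * measure M (ball x R) powr (1 / Q)"
      unfolding k_def using step by (intro radius_le_of_halving[OF K Q R])
    then have "R powr Q \<le> (k * measure M (ball x R) powr (1 / Q)) powr Q"
      using R Q by (intro powr_mono2) auto
    also have "\<dots> = k powr Q * measure M (ball x R)"
      using k Q by (simp add: powr_mult powr_powr)
    finally have "k powr (- Q) * R powr Q \<le> measure M (ball x R)"
      using k by (simp add: powr_minus field_simps)
    then show "ennreal (k powr (- Q) * R powr Q) \<le> emeasure M (ball x R)"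
      unfolding emeasure_ball(1)[OF R] by (rule ennreal_leI)
  qed
  then show ?thesis using k by (intro exI[of _ "k powr (- Q)"]) auto
qed

end

theorem theorem10:
  fixes M :: "'a::metric_space measure"
    and X :: "('a \<Rightarrow> real) set" and N :: "('a \<Rightarrow> real) \<Rightarrow> real"
    and Q \<theta> p p0 :: real and q :: ennreal
  assumes "metric_measure_space M"
    and "0 < Q" and "0 < \<theta>" and "\<theta> < 1" and "0 < p" and "0 < q" and "p0 = min 1 p"
    and "ri_space M X N"
    and "ri_space M (convexify M (1 / p) X) (convexify_norm (1 / p) N)"
    and "D_const M X N p < \<infinity>"
  shows "(\<exists>C::real. 0 < C \<and>
            (\<forall>f \<in> borel_measurable M. (\<lambda>x. \<bar>f x\<bar> powr p0) \<in> L1_plus_Linf M \<longrightarrow>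
               Lq_dt_over_t q
                 (\<lambda>t. ennreal (fundamental M N t * t powr (- (\<theta> / Q))) *
                      epow (osc M (\<lambda>x. \<bar>f x\<bar> powr p0) t) (1 / p0))
               \<le> ennreal C * besov_seminorm M X N \<theta> p q f))
         \<longleftrightarrow> (\<exists>c::real. 0 < c \<and> (\<forall>r>0. ennreal (c * r powr Q) \<le> ball_growth M r))"
proof -
  interpret metric_measure_space M by fact
  note spaces = \<open>ri_space M X N\<close> \<open>ri_space M (convexify M (1 / p) X) (convexify_norm (1 / p) N)\<close>
  show ?thesis (is "?inequality \<longleftrightarrow> ?growth")
  proof
    assume ?inequality
    then obtain C :: real where "0 < C" and
      ineq: "\<And>f. f \<in> borel_measurable M \<Longrightarrow> (\<lambda>x. \<bar>f x\<bar> powr p0) \<in> L1_plus_Linf M \<Longrightarrow>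
        Lq_dt_over_t q (\<lambda>t. ennreal (fundamental M N t * t powr (- (\<theta> / Q))) *
          epow (osc M (\<lambda>x. \<bar>f x\<bar> powr p0) t) (1 / p0)) \<le> ennreal C * besov_seminorm M X N \<theta> p q f"
      by blast
    show ?growth
      using lower_bound_if_oscillation_inequality[OF spaces assms(10,2,3,4,5,7,6) \<open>0 < C\<close> ineq] .
  next
    assume ?growth
    then obtain c :: real where "0 < c" "\<And>r. 0 < r \<Longrightarrow> ennreal (c * r powr Q) \<le> ball_growth M r"
      by blast
    then show ?inequality
      using assms by (intro oscillation_inequality_if_lower_bound[OF spaces])
  qed
qed

end
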